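(* Let $n \geq 9$ and let $k \in \{1, 2, \dotsc, \lfloor n/2 \rfloor\}$. Then there exists a constant $a_k = \frac{n}{k} + \alpha_k$ with $|\alpha_k| \leq \frac{10}{n}$ such that \[ P_k^\circ - Z \;\subset\; T_n - Z \;\subset\; a_k\,(P_k^\circ - Z). \]
   Context: Let $N = n(n-1)/2$ and index the coordinates of $\mathbb{R}^N$ by unordered pairs $\{i,j\}$ of distinct elements of $\{1,\dotsc,n\}$. Let $X \subset \mathbb{R}^N$ be the set of incidence vectors of Hamiltonian cycles of $K_n$ ($x_{ij}=1$ if the cycle uses edge $\{i,j\}$, else $0$). The symmetric traveling salesman polytope is $T_n = \operatorname{conv}(X)$, and $Z$ is its barycenter, the vector with all coordinates equal to $\frac{2}{n-1}$. For a function $f:X\to\mathbb{R}$, let $q_f(h) = \frac{1}{|X|}\sum_{x\in X} f(x)h(x)^2$ be the associated quadratic form on the space of real polynomials of degree at most $k$ on $\mathbb{R}^N$. Let $P_k$ be the set of linear functions $g$ on $\mathbb{R}^N$ (considered via their restriction to $X$) with average value $1$ on $X$ such that $q_g$ is positive semidefinite on polynomials of degree at most $k$. Define $P_k^\circ$ to be the set of points $z$ in the affine span of $X$ such that $g(z) \ge 0$ for all $g \in P_k$. *)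

theory Defs
  imports Complex_Main "HOL-Library.Multiset"
begin

text \<open>Coordinates of R^N are indexed by the edges {i,j} of K_n on vertex set {1..n}.
  A point of R^N is represented as a function from edges (nat sets) to reals; all
  points considered below vanish off the edge set.\<close>

definition edges :: "nat \<Rightarrow> nat set set" where
  "edges n = {{i, j} | i j. i \<in> {1..n} \<and> j \<in> {1..n} \<and> i \<noteq> j}"

definition ham_cycles :: "nat \<Rightarrow> nat set set set" where
  "ham_cycles n = {{{p i, p ((i + 1) mod n)} | i. i < n} | p. bij_betw p {..<n} {1..n}}"

definition tsp_vertices :: "nat \<Rightarrow> (nat set \<Rightarrow> real) set" where
  "tsp_vertices n = (\<lambda>C e. if e \<in> C then 1 else 0) ` ham_cycles n"

definition barycenter :: "nat \<Rightarrow> nat set \<Rightarrow> real" where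
  "barycenter n = (\<lambda>e. if e \<in> edges n then 2 / (real n - 1) else 0)"

definition tsp_polytope :: "nat \<Rightarrow> (nat set \<Rightarrow> real) set" where
  "tsp_polytope n = {z. \<exists>\<mu>. (\<forall>x\<in>tsp_vertices n. \<mu> x \<ge> 0) \<and>
       (\<Sum>x\<in>tsp_vertices n. \<mu> x) = 1 \<and>
       z = (\<lambda>e. \<Sum>x\<in>tsp_vertices n. \<mu> x * x e)}"

definition tsp_aff :: "nat \<Rightarrow> (nat set \<Rightarrow> real) set" where
  "tsp_aff n = {z. \<exists>\<mu>. (\<Sum>x\<in>tsp_vertices n. \<mu> x) = 1 \<and>
       z = (\<lambda>e. \<Sum>x\<in>tsp_vertices n. \<mu> x * x e)}"

definition linfun :: "nat \<Rightarrow> (nat set \<Rightarrow> real) \<Rightarrow> (nat set \<Rightarrow> real) \<Rightarrow> real" where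
  "linfun n c = (\<lambda>x. \<Sum>e\<in>edges n. c e * x e)"

definition poly_deg_le :: "nat \<Rightarrow> nat \<Rightarrow> ((nat set \<Rightarrow> real) \<Rightarrow> real) \<Rightarrow> bool" where
  "poly_deg_le n k h \<longleftrightarrow> (\<exists>c :: nat set multiset \<Rightarrow> real.
     h = (\<lambda>x. \<Sum>S\<in>{S. set_mset S \<subseteq> edges n \<and> size S \<le> k}. c S * (\<Prod>e\<in>#S. x e)))"

definition q_form :: "nat \<Rightarrow> ((nat set \<Rightarrow> real) \<Rightarrow> real) \<Rightarrow> ((nat set \<Rightarrow> real) \<Rightarrow> real) \<Rightarrow> real" where
  "q_form n f h = (1 / real (card (tsp_vertices n))) * (\<Sum>x\<in>tsp_vertices n. f x * (h x)\<^sup>2)"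

text \<open>P_k, represented by the coefficient vectors of the linear functions g.\<close>
definition P_set :: "nat \<Rightarrow> nat \<Rightarrow> (nat set \<Rightarrow> real) set" where
  "P_set n k = {c. (1 / real (card (tsp_vertices n))) * (\<Sum>x\<in>tsp_vertices n. linfun n c x) = 1 \<and>
      (\<forall>h. poly_deg_le n k h \<longrightarrow> q_form n (linfun n c) h \<ge> 0)}"

definition P_polar :: "nat \<Rightarrow> nat \<Rightarrow> (nat set \<Rightarrow> real) set" where
  "P_polar n k = {z \<in> tsp_aff n. \<forall>c\<in>P_set n k. linfun n c z \<ge> 0}"

end

theory Submission
  imports Defs "HOL-Combinatorics.Multiset_Permutations" "HOL-Library.Disjoint_Sets" "HOL-Library.FuncSet"
begin

text \<open>The left inclusion is Farkas' lemma: every nonnegative linear function on X of average 1 lies in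
  P_k. For the right one it suffices to write Z + (x - Z) / a, for a vertex x, as the mean of y
  over X under a density that is a sum of squares of polynomials of degree at most k. Take the
  indicators of "y contains S", where S is a random k-subset of a maximum matching of x, rotated
  uniformly along x. The mean of y given S is known explicitly (insert vertices one at a time into a
  Hamiltonian cycle): a further edge uv has probability 2 / (n - k - 1), halved for each endpoint
  covered by S. Two vertices not adjacent in x are never matched with each other, so the mean
  takes one value on all edges outside x, and by rotation one value on the edges of x. This is
  Z + (x - Z) / a, and a is read off from the value outside x.\<close>

section \<open>Hamiltonian cycles as cyclic lists\<close>

text \<open>If g lies in P_k and the density is a sum of squares h^2, the value of g at the mean of
  y is, up to a positive factor, the sum of the numbers q_g(h), hence nonnegative. So such a mean
  lies in the polar; 1 / a measures how strongly it is pulled towards x. Matchings are used because,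
  given a matching, the probability of a further edge factorises over its two endpoints. The
  obstacle is uniformity: a fixed matching singles out some edges of x and, for odd n, misses a
  vertex. Rotation removes both asymmetries. Two values then remain, tied by the fact that every
  cycle has n edges, so only the simpler one, outside x, has to be computed. The outcome is exact: a
  = (n / k) * (1 + (k - 1) / D), where D is (n - 2)^2 - (n - 1) * (k - 1) for even n and (n - 2) *
  (n - k - 2) for odd n. In both cases D \<ge> (n - 2) * (n - 3) / 2, and n^2 \<le> 10 * D is the
  source of the constant 10.\<close>

definition cyc_edge :: "'a list \<Rightarrow> nat \<Rightarrow> 'a set" where
  "cyc_edge xs i = {xs ! (i mod length xs), xs ! (Suc i mod length xs)}"

text \<open>Taking the range over all naturals, with indices read modulo the length, turns rotation
  of the list into a mere shift of the index.\<close>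

definition cyc :: "'a list \<Rightarrow> 'a set set" where
  "cyc xs = range (cyc_edge xs)"

lemma cyc_edge_mod: "cyc_edge xs (i mod length xs) = cyc_edge xs i"
  by (simp add: cyc_edge_def mod_Suc_eq)

lemma cyc_edge_rotate: "xs \<noteq> [] \<Longrightarrow> cyc_edge (rotate r xs) i = cyc_edge xs (r + i)"
  by (simp add: cyc_edge_def nth_rotate mod_add_right_eq mod_simps)

lemma cyc_eq: "xs \<noteq> [] \<Longrightarrow> cyc xs = cyc_edge xs ` {..<length xs}"
  unfolding cyc_def by (auto intro!: image_eqI[of _ _ "_ mod length xs"] simp: cyc_edge_mod)

lemma cyc_rotate: "cyc (rotate r xs) = cyc xs"
proof (cases "xs = []")
  case False
  have "cyc_edge xs i \<in> range (\<lambda>i. cyc_edge xs (r + i))" for i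
  proof
    \<comment> \<open>The witness \<open>i + (r * length xs - r)\<close> is i - r modulo the length;
      this inequality keeps the subtraction of naturals exact.\<close>
    have "r \<le> r * length xs" using False by (cases xs) auto
    then have "r + (i + (r * length xs - r)) = i + r * length xs" by linarith
    then have "(r + (i + (r * length xs - r))) mod length xs = i mod length xs"
      by (metis mod_mult_self1)
    then show "cyc_edge xs i = cyc_edge xs (r + (i + (r * length xs - r)))"
      by (metis cyc_edge_mod)
  qed simp
  then show ?thesis using False by (auto simp: cyc_def cyc_edge_rotate)
qed simp

lemma cyc_edge_subset: "xs \<noteq> [] \<Longrightarrow> cyc_edge xs i \<subseteq> set xs"
  by (simp add: cyc_edge_def)

lemma mem_cyc_edge:
  assumes "distinct xs" "i < length xs" "j < length xs"
  shows "xs ! i \<in> cyc_edge xs j \<longleftrightarrow> j = i \<or> Suc j mod length xs = i"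
proof -
  have "Suc j mod length xs < length xs" using assms by (intro mod_less_divisor) auto
  then show ?thesis using assms by (auto simp: cyc_edge_def nth_eq_iff_index_eq)
qed

lemma Suc_mod_eq_iff: 
  assumes "i < n" "j < (n::nat)"
  shows "Suc j mod n = i \<longleftrightarrow> j = (if i = 0 then n - 1 else i - 1)"
  using assms by (cases "Suc j = n") auto

lemma cyc_edge_pair:
  assumes "distinct xs" "length xs \<ge> 2"
  shows "cyc_edge xs i \<subseteq> set xs" "card (cyc_edge xs i) = 2"
proof -
  have ne: "xs \<noteq> []" using assms by auto
  show "cyc_edge xs i \<subseteq> set xs" using ne by (rule cyc_edge_subset)
  have "Suc i mod length xs \<noteq> i mod length xs" using assms(2) by (auto simp: mod_Suc)
  then show "card (cyc_edge xs i) = 2"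
    using assms ne by (simp add: cyc_edge_def nth_eq_iff_index_eq)
qed

text \<open>If two different positions gave the same edge, each would be the cyclic successor of the
  other, which forces length 2.\<close>

lemma inj_on_cyc_edge:
  assumes "distinct xs" "length xs \<ge> 3"
  shows "inj_on (cyc_edge xs) {..<length xs}"
proof
  fix i j assume ij: "i \<in> {..<length xs}" "j \<in> {..<length xs}" and eq: "cyc_edge xs i = cyc_edge xs j"
  have "xs ! i \<in> cyc_edge xs j" "xs ! j \<in> cyc_edge xs i"
    using eq ij by (auto simp: cyc_edge_def)
  then have "j = i \<or> Suc j mod length xs = i" "i = j \<or> Suc i mod length xs = j"
    using mem_cyc_edge[OF assms(1)] ij by auto
  then show "i = j" using ij assms(2)
    by (auto simp: Suc_mod_eq_iff split: if_splits)
qed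

lemma card_cyc:
  assumes "distinct xs" "length xs \<ge> 3"
  shows "card (cyc xs) = length xs"
proof -
  have "xs \<noteq> []" using assms by auto
  then show ?thesis using inj_on_cyc_edge[OF assms] by (simp add: cyc_eq card_image)
qed

lemma finite_cyc: "xs \<noteq> [] \<Longrightarrow> finite (cyc xs)"
  by (simp add: cyc_eq)

lemma card_cyc_incident:
  assumes "distinct xs" "length xs \<ge> 3" "u \<in> set xs"
  shows "card {e \<in> cyc xs. u \<in> e} = 2"
proof -
  have ne: "xs \<noteq> []" using assms by auto
  obtain i where i: "i < length xs" "u = xs ! i" using assms(3) by (auto simp: in_set_conv_nth)
  let ?j = "if i = 0 then length xs - 1 else i - 1"
  have "{e \<in> cyc xs. u \<in> e} = cyc_edge xs ` {j \<in> {..<length xs}. u \<in> cyc_edge xs j}"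
    using ne by (auto simp: cyc_eq)
  also have "{j \<in> {..<length xs}. u \<in> cyc_edge xs j} = {i, ?j}"
    using i mem_cyc_edge[OF assms(1) i(1)] by (auto simp: Suc_mod_eq_iff)
  finally have *: "{e \<in> cyc xs. u \<in> e} = cyc_edge xs ` {i, ?j}" .
  have "card (cyc_edge xs ` {i, ?j}) = card {i, ?j}"
    by (rule card_image, rule inj_on_subset[OF inj_on_cyc_edge[OF assms(1,2)]]) (use i in auto)
  moreover have "card {i, ?j} = 2" using i assms(2) by auto
  ultimately show ?thesis using * by simp
qed

definition path_edges :: "'a list \<Rightarrow> 'a set set" where
  "path_edges xs = cyc_edge xs ` {..<length xs - 1}"

text \<open>Rotating by \<open>Suc r\<close> moves the edge at position \<open>r\<close> to the
  closing position, the one that \<open>path_edges\<close> omits. Hence the rotations run through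
  all ways of cutting the cycle open at one edge.\<close>

lemma path_edges_rotate:
  assumes "distinct xs" "length xs \<ge> 3" 
  shows "path_edges (rotate (Suc r) xs) = cyc xs - {cyc_edge xs r}"
proof -
  let ?n = "length xs" and ?ys = "rotate (Suc r) xs"
  have ne: "xs \<noteq> []" using assms by auto
  have "{..<?n - 1} = {..<length ?ys} - {?n - 1}" by auto
  then have "path_edges ?ys = cyc ?ys - {cyc_edge ?ys (?n - 1)}"
    unfolding path_edges_def using ne assms
      inj_on_image_set_diff[OF inj_on_cyc_edge[of ?ys], of "{..<?n}" "{?n - 1}"]
    by (auto simp: cyc_eq)
  moreover have "cyc_edge ?ys (?n - 1) = cyc_edge xs r"
  proof -
    have "cyc_edge ?ys (?n - 1) = cyc_edge xs (Suc r + (?n - 1))"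
      using ne by (rule cyc_edge_rotate)
    also have "Suc r + (?n - 1) = r + ?n" using assms by simp
    also have "cyc_edge xs (r + ?n) = cyc_edge xs r" by (metis cyc_edge_mod mod_add_self2)
    finally show ?thesis .
  qed
  ultimately show ?thesis by (simp only: cyc_rotate)
qed

lemma cyc_Cons:
  assumes "ys \<noteq> []"
  shows "cyc (v # ys) = {{v, hd ys}, {last ys, v}} \<union> path_edges ys"
proof -
  let ?m = "length ys"
  have "{..<length (v # ys)} = {0, ?m} \<union> Suc ` {..<?m - 1}"
    using assms by (auto simp: image_iff less_Suc_eq_0_disj)
      (metis Suc_pred lessThan_iff less_SucE length_greater_0_conv)
  moreover have "cyc_edge (v # ys) 0 = {v, hd ys}" "cyc_edge (v # ys) ?m = {last ys, v}"
    using assms by (auto simp: cyc_edge_def hd_conv_nth last_conv_nth nth_Cons')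
  moreover have "cyc_edge (v # ys) (Suc i) = cyc_edge ys i" if "i < ?m - 1" for i
    using that by (simp add: cyc_edge_def)
  ultimately show ?thesis by (simp add: cyc_eq path_edges_def image_image image_Un)
qed

text \<open>Counts orderings of V, so a cycle is counted once for each starting point and direction.\<close>
definition ham_count :: "'a set \<Rightarrow> 'a set set \<Rightarrow> real" where
  "ham_count V F = (\<Sum>xs\<in>permutations_of_set V. of_bool (F \<subseteq> cyc xs))"

lemma sum_rotate_permutations:
  "(\<Sum>xs\<in>permutations_of_set V. f (rotate r xs)) = (\<Sum>xs\<in>permutations_of_set V. f xs)"
proof (rule sum.reindex_bij_betw)
  have inj: "inj_on (rotate r) (permutations_of_set V)"
    unfolding rotate_def by (rule inj_on_subset[OF inj_fn[OF inj_rotate1]]) simp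
  show "bij_betw (rotate r) (permutations_of_set V) (permutations_of_set V)"
    unfolding bij_betw_def
  proof
    show "rotate r ` permutations_of_set V = permutations_of_set V"
    proof (rule endo_inj_surj[OF _ _ inj])
      show "finite (permutations_of_set V)" by simp
    qed (auto simp: permutations_of_set_def)
  qed (rule inj)
qed

text \<open>Each ordering has \<open>v\<close> at exactly one position, and rotating
  \<open>v\<close> to the front does not change the cycle. So all \<open>card V\<close> positions
  contribute equally.\<close>

lemma ham_count_Cons:
  assumes V: "finite V" "v \<in> V"
  shows "ham_count V F = real (card V) * (\<Sum>ys\<in>permutations_of_set (V - {v}). of_bool (F \<subseteq> cyc (v # ys)))"
proof -
  let ?L = "permutations_of_set V"
  let ?f = "\<lambda>xs. of_bool (F \<subseteq> cyc xs) :: real"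
  have len: "length xs = card V" if "xs \<in> ?L" for xs
    using that by (simp add: length_finite_permutations_of_set)
  have n: "card V > 0" using V by (auto simp: card_gt_0_iff)
  have one: "(\<Sum>i<card V. of_bool (xs ! i = v)) = (1::real)" if xs: "xs \<in> ?L" for xs
  proof -
    from xs V obtain i where i: "i < card V" "xs ! i = v"
      using len[OF xs] by (metis in_set_conv_nth permutations_of_setD(1))
    then have "{j\<in>{..<card V}. xs ! j = v} = {i}"
      using permutations_of_setD(2)[OF xs] len[OF xs] by (auto simp: nth_eq_iff_index_eq)
    then show ?thesis by (simp add: of_bool_def sum.If_cases Int_def)
  qed
  have "ham_count V F = (\<Sum>xs\<in>?L. \<Sum>i<card V. ?f xs * of_bool (xs ! i = v))"
    unfolding ham_count_def sum_distrib_left[symmetric]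
    by (rule sum.cong[OF refl]) (simp only: one mult_1_right)
  also have "\<dots> = (\<Sum>i<card V. \<Sum>xs\<in>?L. ?f xs * of_bool (xs ! i = v))"
    by (rule sum.swap)
  also have "\<dots> = (\<Sum>i<card V. \<Sum>xs\<in>?L. ?f xs * of_bool (xs ! 0 = v))"
  proof (rule sum.cong[OF refl])
    fix i assume i: "i \<in> {..<card V}"
    have "(\<Sum>xs\<in>?L. ?f xs * of_bool (xs ! 0 = v))
      = (\<Sum>xs\<in>?L. ?f (rotate i xs) * of_bool (rotate i xs ! 0 = v))"
      by (rule sum_rotate_permutations[symmetric])
    also have "\<dots> = (\<Sum>xs\<in>?L. ?f xs * of_bool (xs ! i = v))"
      by (rule sum.cong[OF refl]) (use i n len in \<open>auto simp: cyc_rotate nth_rotate\<close>)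
    finally show "(\<Sum>xs\<in>?L. ?f xs * of_bool (xs ! i = v)) = (\<Sum>xs\<in>?L. ?f xs * of_bool (xs ! 0 = v))"
      by simp
  qed
  also have "\<dots> = real (card V) * (\<Sum>xs\<in>?L. ?f xs * of_bool (xs ! 0 = v))" by simp
  also have "(\<Sum>xs\<in>?L. ?f xs * of_bool (xs ! 0 = v)) = (\<Sum>xs\<in>{xs\<in>?L. xs ! 0 = v}. ?f xs)"
    unfolding sum.inter_filter[OF finite_permutations_of_set] by (rule sum.cong[OF refl]) simp
  also have "{xs\<in>?L. xs ! 0 = v} = (#) v ` permutations_of_set (V - {v})"
    using V by (subst permutations_of_set_nonempty) auto
  also have "sum ?f \<dots> = (\<Sum>ys\<in>permutations_of_set (V - {v}). of_bool (F \<subseteq> cyc (v # ys)))"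
    by (subst sum.reindex) auto
  finally show ?thesis .
qed

lemma path_edges_subset_set: "ys \<noteq> [] \<Longrightarrow> e \<in> path_edges ys \<Longrightarrow> e \<subseteq> set ys"
  unfolding path_edges_def using cyc_edge_subset by fastforce

lemma sum_of_bool_card: "finite A \<Longrightarrow> (\<Sum>x\<in>A. of_bool (P x)) = real (card {x\<in>A. P x})"
  by (simp add: of_bool_def sum.If_cases Int_def)

lemma hd_last_rotate:
  assumes "xs \<noteq> []"
  shows "cyc_edge xs r = {last (rotate (Suc r) xs), hd (rotate (Suc r) xs)}"
proof -
  have "Suc r + (length xs - 1) = r + length xs" using assms by (cases xs) auto
  then have "(Suc r + (length xs - 1)) mod length xs = r mod length xs"
    by (simp only: mod_add_self2)
  then show ?thesis using assms
    by (simp only: cyc_edge_def last_conv_nth hd_conv_nth nth_rotate length_rotate rotate_is_Nil_conv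
        length_greater_0_conv diff_less zero_less_one add_0_right not_False_eq_True)
qed

text \<open>Deleting v from a Hamiltonian cycle and putting it back into any of the edges of the
  remaining cycle splits the cycles on V into classes; in a class that meets S, all but card S
  of the insertion points keep S, and 2 - deg(u) of these are next to u.\<close>
lemma ham_count_insert:
  assumes V: "finite V" "card V \<ge> 4" "v \<in> V" "u \<in> V" "u \<noteq> v"
    and S: "finite S" "v \<notin> \<Union>S"
  shows "(real (card V) - 1 - real (card S)) * ham_count V (insert {v, u} S)
    = (2 - real (card {e \<in> S. u \<in> e})) * ham_count V S"
proof -
  let ?M = "permutations_of_set (V - {v})" and ?m = "card V - 1"
  define d where "d = card {e \<in> S. u \<in> e}"
  have m: "card (V - {v}) = ?m" "?m \<ge> 3" using V by auto
  have ys: "distinct ys" "set ys = V - {v}" "length ys = ?m" "length ys \<ge> 3" "ys \<noteq> []"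
    if "ys \<in> ?M" for ys
  proof -
    show "distinct ys" "set ys = V - {v}" using that by (auto simp: permutations_of_set_def)
    show "length ys = ?m" using that length_finite_permutations_of_set[OF that] m by simp
    then show "length ys \<ge> 3" "ys \<noteq> []" using m by auto
  qed
  \<comment> \<open>\<open>A\<close> and \<open>B\<close> are the two counts of the claim up to the
    factor \<open>card V\<close>: cycles cut open without losing S, and among them those cut next to
    \<open>u\<close>. \<open>Y\<close> counts the uncut cycles and links the two.\<close>
  define Y where "Y = (\<Sum>ys\<in>?M. of_bool (S \<subseteq> cyc ys) :: real)"
  define A where "A = (\<Sum>ys\<in>?M. of_bool (S \<subseteq> path_edges ys) :: real)"
  define B where "B = (\<Sum>ys\<in>?M. of_bool (S \<subseteq> path_edges ys \<and> u \<in> {last ys, hd ys}) :: real)"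
  have "S \<subseteq> cyc (v # ys) \<longleftrightarrow> S \<subseteq> path_edges ys" if "ys \<in> ?M" for ys
    using S(2) by (auto simp: cyc_Cons ys(5)[OF that])
  then have hA: "ham_count V S = real (card V) * A"
    unfolding A_def ham_count_Cons[OF V(1,3)] by simp
  have "insert {v, u} S \<subseteq> cyc (v # ys) \<longleftrightarrow> S \<subseteq> path_edges ys \<and> u \<in> {last ys, hd ys}"
    if "ys \<in> ?M" for ys
  proof -
    have "{v, u} \<notin> path_edges ys" using path_edges_subset_set[OF ys(5)[OF that]] ys(2)[OF that] by blast
    then show ?thesis
      using S(2) V(5) by (auto simp: cyc_Cons ys(5)[OF that] doubleton_eq_iff)
  qed
  then have hB: "ham_count V (insert {v, u} S) = real (card V) * B"
    unfolding B_def ham_count_Cons[OF V(1,3)] by simp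
  \<comment> \<open>Letting every edge take its turn as the closing edge replaces the single cut by
    all \<open>?m\<close> cuts of the same cycle.\<close>
  have rot: "real ?m * (\<Sum>ys\<in>?M. g ys) = (\<Sum>ys\<in>?M. \<Sum>r<?m. g (rotate (Suc r) ys))"
    for g :: "'a list \<Rightarrow> real"
    by (subst sum.swap) (simp add: sum_rotate_permutations del: rotate_Suc)
  \<comment> \<open>For a cycle containing S the admissible cuts are its edges outside S. The
    predicate is instantiated with truth for \<open>A\<close> and with incidence to \<open>u\<close>
    for \<open>B\<close>.\<close>
  have pe: "(\<Sum>r<?m. of_bool (S \<subseteq> path_edges (rotate (Suc r) ys) \<and> P (cyc_edge ys r)) :: real)
     = of_bool (S \<subseteq> cyc ys) * (card {e\<in>cyc ys. P e} - real (card {e\<in>S. P e}))"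
    if ysM: "ys \<in> ?M" for ys P
  proof -
    have "(\<Sum>r<?m. of_bool (S \<subseteq> path_edges (rotate (Suc r) ys) \<and> P (cyc_edge ys r)) :: real)
      = (\<Sum>r<?m. of_bool (S \<subseteq> cyc ys \<and> cyc_edge ys r \<notin> S \<and> P (cyc_edge ys r)))"
      by (rule sum.cong) (auto simp: path_edges_rotate ys(1,4)[OF ysM] simp del: rotate_Suc)
    also have "\<dots> = (\<Sum>e\<in>cyc ys. of_bool (S \<subseteq> cyc ys \<and> e \<notin> S \<and> P e))"
      unfolding cyc_eq[OF ys(5)[OF ysM]] ys(3)[OF ysM]
      by (subst sum.reindex) (use inj_on_cyc_edge[OF ys(1,4)[OF ysM]] ys(3)[OF ysM] in auto)
    also have "\<dots> = of_bool (S \<subseteq> cyc ys) * real (card ({e\<in>cyc ys. P e} - {e\<in>S. P e}))"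
      by (auto simp: sum_of_bool_card finite_cyc ys(5)[OF ysM] intro!: arg_cong[of _ _ card])
    also have "\<dots> = of_bool (S \<subseteq> cyc ys) * (card {e\<in>cyc ys. P e} - real (card {e\<in>S. P e}))"
    proof (cases "S \<subseteq> cyc ys")
      case True
      then have "{e\<in>S. P e} \<subseteq> {e\<in>cyc ys. P e}" by auto
      then show ?thesis
        by (simp add: card_Diff_subset card_mono of_nat_diff finite_cyc ys(5)[OF ysM] S(1) True)
    qed simp
    finally show ?thesis .
  qed
  have A: "real ?m * A = (?m - real (card S)) * Y"
  proof -
    have "real ?m * A = (\<Sum>ys\<in>?M. of_bool (S \<subseteq> cyc ys) * (?m - real (card S)))"
      unfolding A_def rot
    proof (rule sum.cong[OF refl])
      fix ys assume "ys \<in> ?M"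
      then show "(\<Sum>r<?m. of_bool (S \<subseteq> path_edges (rotate (Suc r) ys)))
        = of_bool (S \<subseteq> cyc ys) * (?m - real (card S))"
        using pe[of ys "\<lambda>_. True"] card_cyc[of ys] ys[of ys] by simp
    qed
    then show ?thesis by (simp add: Y_def sum_distrib_right mult.commute)
  qed
  have B: "real ?m * B = (2 - real d) * Y"
  proof -
    have "real ?m * B = (\<Sum>ys\<in>?M. of_bool (S \<subseteq> cyc ys) * (2 - real d))"
      unfolding B_def rot
    proof (rule sum.cong[OF refl])
      fix ys assume "ys \<in> ?M"
      then show "(\<Sum>r<?m. of_bool (S \<subseteq> path_edges (rotate (Suc r) ys) \<and>
           u \<in> {last (rotate (Suc r) ys), hd (rotate (Suc r) ys)}))
        = of_bool (S \<subseteq> cyc ys) * (2 - real d)"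
        using pe[of ys "\<lambda>e. u \<in> e"] card_cyc_incident[of ys u] ys[of ys] V
        by (simp add: d_def hd_last_rotate del: rotate_Suc)
    qed
    then show ?thesis by (simp add: Y_def sum_distrib_right mult.commute)
  qed
  \<comment> \<open>Both sides equal \<open>(?m - card S) * (2 - d) * Y\<close>. Only
    \<open>?m\<close> is cancelled, since \<open>?m - card S\<close> may vanish; hence the
    conclusion is a product and not a quotient.\<close>
  have "real ?m * ((?m - real (card S)) * B) = real ?m * ((2 - real d) * A)"
    using A B by (metis mult.left_commute)
  then have "(?m - real (card S)) * B = (2 - real d) * A" using m by auto
  moreover have "real ?m = real (card V) - 1" using m(2) by (simp add: of_nat_diff)
  ultimately show ?thesis
    unfolding hA hB d_def[symmetric] by (metis mult.left_commute)
qed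

section \<open>Hamiltonian cycles through a matching\<close>

definition matching :: "'a set \<Rightarrow> 'a set set \<Rightarrow> bool" where
  "matching V S \<longleftrightarrow> (\<forall>e\<in>S. e \<subseteq> V \<and> card e = 2) \<and> disjoint S"

lemma matching_subset: "matching V S \<Longrightarrow> S' \<subseteq> S \<Longrightarrow> matching V S'"
  unfolding matching_def disjoint_def by blast

lemma finite_matching: "finite V \<Longrightarrow> matching V S \<Longrightarrow> finite S"
  by (rule finite_subset[of _ "Pow V"]) (auto simp: matching_def)

lemma matching_degree:
  assumes "matching V S"
  shows "card {e \<in> S. u \<in> e} = of_bool (u \<in> \<Union>S)"
proof (cases "u \<in> \<Union>S")
  case True
  then obtain e where e: "e \<in> S" "u \<in> e" by blast
  then have "{e \<in> S. u \<in> e} = {e}"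
    using assms unfolding matching_def disjoint_def by blast
  then show ?thesis using True by simp
next
  case False
  then have "{e \<in> S. u \<in> e} = {}" by blast
  then show ?thesis using False by (simp only: card.empty of_bool_eq)
qed

lemma matching_edge_removal:
  assumes "matching V S" "e \<in> S" "v \<in> e"
  shows "v \<notin> \<Union>(S - {e})"
  using assms unfolding matching_def disjoint_def by blast

lemma ham_count_matching_step:
  assumes V: "finite V" "card V \<ge> 4" and S: "matching V S" "e \<in> S"
  shows "(real (card V) - real (card S)) * ham_count V S = 2 * ham_count V (S - {e})"
proof -
  have fin: "finite S" using finite_matching[OF V(1) S(1)] .
  obtain v u where e: "e = {v, u}" "u \<noteq> v" "v \<in> V" "u \<in> V"
    using S unfolding matching_def by (metis card_2_iff insert_subset)
  have *: "v \<notin> \<Union>(S - {e})" "u \<notin> \<Union>(S - {e})" using matching_edge_removal[OF S] e by auto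
  have "card {e' \<in> S - {e}. u \<in> e'} = 0"
    using matching_degree[OF matching_subset[OF S(1)], of "S - {e}" u] *(2) by simp
  moreover have "insert {v, u} (S - {e}) = S" using S(2) e(1) by auto
  moreover have "real (card V) - 1 - real (card (S - {e})) = real (card V) - card S"
    using card_Suc_Diff1[OF fin S(2)] by simp
  ultimately show ?thesis
    using ham_count_insert[OF V e(3,4,2) finite_Diff[OF fin] *(1)]
    by (simp only: of_nat_0 diff_zero)
qed

text \<open>For k = \<open>card S\<close> and n = \<open>card V\<close> this is the count n * 2^k *
  (n - 1 - k)! known from contracting the edges of the matching and orienting them. Here the edges
  are added one by one, each at the price of one factor.\<close>

lemma ham_count_matching:
  assumes V: "finite V" "card V \<ge> 4" and S: "matching V S" "2 * card S \<le> card V"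
  shows "ham_count V S = ham_count V {} * (\<Prod>i<card S. 2 / (real (card V) - 1 - real i))"
proof -
  have "finite S" using finite_matching[OF V(1) S(1)] .
  then show ?thesis using S
  proof (induction rule: finite_induct)
    case (insert e S)
    have S: "matching V S" using insert.prems(1) by (rule matching_subset) auto
    have "(real (card V) - 1 - real (card S)) * ham_count V (insert e S) = 2 * ham_count V S"
      using ham_count_matching_step[OF V insert.prems(1), of e] insert.hyps by (simp add: algebra_simps)
    moreover have "real (card V) - 1 - card S > 0" using insert.hyps insert.prems(2) V(2) by simp
    moreover have "ham_count V S = ham_count V {} * (\<Prod>i<card S. 2 / (real (card V) - 1 - real i))"
      using insert.hyps insert.prems(2) by (intro insert.IH[OF S]) simp
    ultimately show ?case using insert.hyps by (simp add: field_simps)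
  qed simp
qed

text \<open>If both endpoints are already covered, exchange the order in which the edges of the
  path of length three through {u, v} are inserted.\<close>
lemma ham_count_matching_extend:
  assumes V: "finite V" "card V \<ge> 4" and S: "matching V S" "2 * card S \<le> card V"
    and uv: "u \<in> V" "v \<in> V" "u \<noteq> v" "{u, v} \<notin> S"
  shows "(real (card V) - 1 - real (card S)) * ham_count V (insert {u, v} S)
    = 2 * (1 - of_bool (u \<in> \<Union>S) / 2) * (1 - of_bool (v \<in> \<Union>S) / 2) * ham_count V S"
proof -
  have fin: "finite S" using finite_matching[OF V(1) S(1)] .
  consider "v \<notin> \<Union>S" | "u \<notin> \<Union>S" | "u \<in> \<Union>S" "v \<in> \<Union>S" by blast
  then show ?thesis
  proof cases
    case 1
    show ?thesis
      using ham_count_insert[OF V uv(2,1,3) fin 1] 1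
      by (simp add: matching_degree[OF S(1)] insert_commute)
  next
    case 2
    show ?thesis
      using ham_count_insert[OF V uv(1,2) uv(3)[symmetric] fin 2] 2
      by (simp add: matching_degree[OF S(1)])
  next
    case 3
    then obtain e where e: "e \<in> S" "v \<in> e" by blast
    then obtain b where b: "e = {b, v}" "b \<noteq> v" "b \<in> V"
      using S(1) unfolding matching_def by (metis card_2_iff insert_commute insert_iff insert_subset singletonD)
    have ub: "u \<noteq> b" using uv(4) e b by auto
    define S0 where "S0 = S - {e}"
    have S0: "matching V S0" "finite S0" "card S0 + 1 = card S"
      using matching_subset[OF S(1)] fin card_Suc_Diff1[OF fin e(1)] by (auto simp: S0_def)
    have nb: "b \<notin> \<Union>S0" "v \<notin> \<Union>S0" using matching_edge_removal[OF S(1) e(1)] b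
      by (auto simp: S0_def)
    have u0: "u \<in> \<Union>S0" using 3(1) b ub uv(3) by (auto simp: S0_def)
    \<comment> \<open>\<open>?F\<close> is reached from \<open>S0\<close> by inserting
      \<open>v\<close> next to the covered \<open>u\<close>, and inserting \<open>b\<close> next to
      \<open>v\<close> then yields \<open>insert {u, v} S\<close>. Each time the old endpoint has
      degree one, so the factor 2 - 1 appears twice. Comparing with the direct step from
      \<open>S0\<close> to \<open>S\<close>, whose factor is 2, gives one half.\<close>
    let ?F = "insert {v, u} S0"
    have "{e \<in> ?F. v \<in> e} = {{v, u}}" using nb by blast
    moreover have "{v, u} \<notin> S0" using uv(4) by (auto simp: S0_def insert_commute)
    then have "card ?F = card S" using S0 by simp
    moreover have "insert {b, v} ?F = insert {u, v} S"
      using b e by (auto simp: S0_def insert_commute)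
    moreover have "b \<notin> \<Union>?F" using nb b ub by auto
    ultimately have F: "(real (card V) - 1 - real (card S)) * ham_count V (insert {u, v} S) = ham_count V ?F"
      using ham_count_insert[OF V b(3) uv(2) b(2)[symmetric], of ?F] S0 by simp
    have "real (card V) - real (card S) = real (card V) - 1 - real (card S0)" using S0(3) by simp
    then have "(real (card V) - real (card S)) * ham_count V ?F
        = (real (card V) - 1 - real (card S0)) * ham_count V ?F"
      by (simp only:)
    also have "\<dots> = ham_count V S0"
      using ham_count_insert[OF V uv(2,1,3) S0(2) nb(2)] u0
      by (simp add: matching_degree[OF S0(1)])
    finally have "(real (card V) - real (card S)) * ham_count V ?F = ham_count V S0" .
    moreover have "(real (card V) - real (card S)) * ham_count V S = 2 * ham_count V S0"
      using ham_count_matching_step[OF V S(1) e(1)] by (simp add: S0_def)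
    ultimately have "(real (card V) - real (card S)) * (2 * ham_count V ?F) = (real (card V) - real (card S)) * ham_count V S"
      by simp
    moreover have "real (card V) - card S \<noteq> 0" using S(2) V(2) by simp
    ultimately have "2 * ham_count V ?F = ham_count V S" by simp
    then show ?thesis using F 3 by simp
  qed
qed

text \<open>Double counting: each cycle through F is met once for each of its \<open>card V\<close>
  edges.\<close>

lemma sum_ham_count_insert:
  assumes V: "finite V" "card V \<ge> 3" and E: "E = {e. e \<subseteq> V \<and> card e = 2}"
  shows "(\<Sum>e\<in>E. ham_count V (insert e F)) = real (card V) * ham_count V F"
proof -
  have "(\<Sum>e\<in>E. ham_count V (insert e F))
    = (\<Sum>xs\<in>permutations_of_set V. \<Sum>e\<in>E. of_bool (F \<subseteq> cyc xs) * of_bool (e \<in> cyc xs))"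
    unfolding ham_count_def by (subst sum.swap) (simp add: of_bool_conj[symmetric] conj_commute)
  also have "\<dots> = (\<Sum>xs\<in>permutations_of_set V. of_bool (F \<subseteq> cyc xs) * real (card V))"
  proof (rule sum.cong[OF refl])
    fix xs assume xs: "xs \<in> permutations_of_set V"
    then have *: "distinct xs" "length xs = card V" "set xs = V"
      by (auto simp: permutations_of_set_def length_finite_permutations_of_set distinct_card)
    have "cyc xs \<subseteq> E"
    proof
      fix e assume "e \<in> cyc xs"
      then obtain i where "e = cyc_edge xs i" by (auto simp: cyc_def)
      then show "e \<in> E" using cyc_edge_pair[of xs i] * V by (simp add: E)
    qed
    then have "{e \<in> E. e \<in> cyc xs} = cyc xs" by auto
    moreover have "finite E" using V by (auto simp: E)
    ultimately show "(\<Sum>e\<in>E. of_bool (F \<subseteq> cyc xs) * of_bool (e \<in> cyc xs)) = of_bool (F \<subseteq> cyc xs) * real (card V)"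
      using card_cyc[of xs] * V by (simp add: sum_distrib_left[symmetric] Int_def)
  qed
  finally show ?thesis by (simp add: ham_count_def sum_distrib_right mult.commute)
qed

lemma ham_count_edge:
  assumes "finite V" "card V \<ge> 4" "e \<subseteq> V" "card e = 2"
  shows "ham_count V {e} = 2 / (real (card V) - 1) * ham_count V {}"
  using ham_count_matching[of V "{e}"] assms by (simp add: matching_def)

section \<open>Random submatchings of a cycle\<close>

text \<open>Position i belongs to the pair i div 2. With J below \<open>length ys div 2\<close>
  these pairs form part of a maximum matching of the cycle; for odd length the last entry has a pair
  index outside every such J.\<close>

definition pairing :: "'a list \<Rightarrow> nat set \<Rightarrow> 'a set set" where
  "pairing ys J = (\<lambda>j. {ys ! (2 * j), ys ! (2 * j + 1)}) ` J"

context
  fixes ys :: "'a list" and J :: "nat set"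
  assumes ys: "distinct ys" and J: "J \<subseteq> {..<length ys div 2}"
begin

lemma pairing_nth_mem_iff:
  assumes "i < length ys" "j \<in> J"
  shows "ys ! i \<in> {ys ! (2 * j), ys ! (2 * j + 1)} \<longleftrightarrow> i div 2 = j"
proof -
  have "2 * j + 1 < length ys" using J assms(2) by force
  then have "ys ! i \<in> {ys ! (2 * j), ys ! (2 * j + 1)} \<longleftrightarrow> i = 2 * j \<or> i = 2 * j + 1"
    using ys assms(1) by (auto simp: nth_eq_iff_index_eq)
  then show ?thesis by linarith
qed

lemma pairing_inj: "inj_on (\<lambda>j. {ys ! (2 * j), ys ! (2 * j + 1)}) J"
proof
  fix i j assume "i \<in> J" "j \<in> J" "{ys ! (2 * i), ys ! (2 * i + 1)} = {ys ! (2 * j), ys ! (2 * j + 1)}"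
  moreover have "2 * i < length ys" using J \<open>i \<in> J\<close> by force
  ultimately show "i = j" using pairing_nth_mem_iff[of "2 * i" j] by auto
qed

lemma card_pairing: "card (pairing ys J) = card J"
  unfolding pairing_def by (rule card_image[OF pairing_inj])

lemma matching_pairing: "matching (set ys) (pairing ys J)"
  unfolding matching_def
proof
  have len: "2 * j + 1 < length ys" if "j \<in> J" for j using J that by force
  then show "\<forall>e\<in>pairing ys J. e \<subseteq> set ys \<and> card e = 2"
    using ys by (fastforce simp: pairing_def nth_eq_iff_index_eq)
  show "disjoint (pairing ys J)"
  proof (rule disjointI)
    fix e f assume "e \<in> pairing ys J" "f \<in> pairing ys J" and "e \<noteq> f"
    then obtain i j where ij: "i \<in> J" "j \<in> J" "i \<noteq> j"
      "e = {ys ! (2 * i), ys ! (2 * i + 1)}" "f = {ys ! (2 * j), ys ! (2 * j + 1)}"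
      unfolding pairing_def by blast
    have "x \<notin> f" if x: "x \<in> e" for x
    proof -
      obtain l where "x = ys ! l" "l \<in> {2 * i, 2 * i + 1}" using x ij(4) by blast
      then have "l < length ys" "x = ys ! l" "l div 2 = i" using len[OF ij(1)] by auto
      then show ?thesis using ij pairing_nth_mem_iff[of l j] by auto
    qed
    then show "e \<inter> f = {}" by blast
  qed
qed

lemma Union_pairing_iff: "i < length ys \<Longrightarrow> ys ! i \<in> \<Union>(pairing ys J) \<longleftrightarrow> i div 2 \<in> J"
  using pairing_nth_mem_iff[of i] unfolding pairing_def by blast

lemma mem_pairing_iff:
  assumes "i < length ys" "j < length ys" "i \<noteq> j"
  shows "{ys ! i, ys ! j} \<in> pairing ys J \<longleftrightarrow> i div 2 = j div 2 \<and> i div 2 \<in> J"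
proof
  assume "{ys ! i, ys ! j} \<in> pairing ys J"
  then obtain l where l: "l \<in> J" "{ys ! i, ys ! j} = {ys ! (2 * l), ys ! (2 * l + 1)}"
    unfolding pairing_def by blast
  then show "i div 2 = j div 2 \<and> i div 2 \<in> J"
    using pairing_nth_mem_iff[of i l] pairing_nth_mem_iff[of j l] assms by auto
next
  assume *: "i div 2 = j div 2 \<and> i div 2 \<in> J"
  then have "{i, j} = {2 * (i div 2), 2 * (i div 2) + 1}"
    using assms(3) by (auto simp: doubleton_eq_iff)
  then have "{ys ! i, ys ! j} = {ys ! (2 * (i div 2)), ys ! (2 * (i div 2) + 1)}"
    by (metis image_empty image_insert)
  then show "{ys ! i, ys ! j} \<in> pairing ys J"
    unfolding pairing_def using * by blast
qed

end

section \<open>Inclusion probabilities of random k-subsets\<close>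

lemma card_supersets:
  assumes "finite A" "T \<subseteq> A" "card T \<le> k"
  shows "card {J. J \<subseteq> A \<and> card J = k \<and> T \<subseteq> J} = (card A - card T) choose (k - card T)"
proof -
  have fT: "finite T" using assms finite_subset by blast
  have "bij_betw (\<lambda>J. J - T) {J. J \<subseteq> A \<and> card J = k \<and> T \<subseteq> J} {J. J \<subseteq> A - T \<and> card J = k - card T}"
  proof (rule bij_betwI[where g = "\<lambda>J. J \<union> T"])
    show "(\<lambda>J. J - T) \<in> {J. J \<subseteq> A \<and> card J = k \<and> T \<subseteq> J} \<rightarrow> {J. J \<subseteq> A - T \<and> card J = k - card T}"
      by (rule Pi_I) (use fT in \<open>simp add: card_Diff_subset Diff_mono\<close>)
    show "(\<lambda>J. J \<union> T) \<in> {J. J \<subseteq> A - T \<and> card J = k - card T} \<rightarrow> {J. J \<subseteq> A \<and> card J = k \<and> T \<subseteq> J}"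
    proof (rule Pi_I)
      fix J assume J: "J \<in> {J. J \<subseteq> A - T \<and> card J = k - card T}"
      then have "finite J" using assms(1) finite_subset by blast
      moreover have "J \<inter> T = {}" using J by auto
      ultimately have "card (J \<union> T) = k" using J assms(3) fT by (simp add: card_Un_disjoint)
      then show "J \<union> T \<in> {J. J \<subseteq> A \<and> card J = k \<and> T \<subseteq> J}" using J assms(2) by auto
    qed
    show "J - T \<union> T = J" if "J \<in> {J. J \<subseteq> A \<and> card J = k \<and> T \<subseteq> J}" for J
      using that by blast
    show "J \<union> T - T = J" if "J \<in> {J. J \<subseteq> A - T \<and> card J = k - card T}" for J
      using that by blast
  qed
  then have "card {J. J \<subseteq> A \<and> card J = k \<and> T \<subseteq> J} = card {J. J \<subseteq> A - T \<and> card J = k - card T}"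
    by (rule bij_betw_same_card)
  then show ?thesis
    using n_subsets[of "A - T"] assms fT by (simp add: card_Diff_subset)
qed

definition ksubsets :: "nat \<Rightarrow> nat \<Rightarrow> nat set set" where
  "ksubsets m k = {J. J \<subseteq> {..<m} \<and> card J = k}"

lemma finite_ksubsets [simp]: "finite (ksubsets m k)"
  by (simp add: ksubsets_def)

lemma card_ksubsets: "card (ksubsets m k) = m choose k"
  by (simp add: ksubsets_def n_subsets)

text \<open>The factor \<open>of_bool (a < m)\<close> is there for odd cycles, where the unmatched
  vertex has pair index m. Multiplying by m instead of dividing turns the claim into binomial
  absorption.\<close>

lemma card_ksubsets_mem:
  "real m * real (card {J\<in>ksubsets m k. a \<in> J}) = of_bool (a < m) * real k * real (m choose k)"
proof (cases "a < m \<and> k > 0")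
  case True
  then have "card {J\<in>ksubsets m k. a \<in> J} = (m - 1) choose (k - 1)"
    using card_supersets[of "{..<m}" "{a}" k] by (simp add: ksubsets_def)
  moreover have "k * (m choose k) = m * ((m - 1) choose (k - 1))"
    using True binomial_absorption[of "k - 1" m] by simp
  ultimately have "m * card {J\<in>ksubsets m k. a \<in> J} = k * (m choose k)" by simp
  then have "real m * real (card {J\<in>ksubsets m k. a \<in> J}) = real k * real (m choose k)"
    by (metis of_nat_mult)
  then show ?thesis using True by simp
next
  case False
  have "{J\<in>ksubsets m k. a \<in> J} = {}"
  proof -
    have "J = {}" if "J \<subseteq> {..<m}" "card J = 0" for J
      using that finite_subset[OF that(1)] by simp
    then show ?thesis using False by (auto simp: ksubsets_def)
  qed
  then show ?thesis using False by auto
qed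

lemma card_ksubsets_mem2:
  assumes "a \<noteq> b"
  shows "real m * (real m - 1) * real (card {J\<in>ksubsets m k. a \<in> J \<and> b \<in> J})
    = of_bool (a < m) * of_bool (b < m) * real k * (real k - 1) * real (m choose k)"
proof (cases "a < m \<and> b < m \<and> k \<ge> 2")
  case True
  then have c: "card {J\<in>ksubsets m k. a \<in> J \<and> b \<in> J} = (m - 2) choose (k - 2)"
    using card_supersets[of "{..<m}" "{a, b}" k] assms by (simp add: ksubsets_def numeral_2_eq_2)
  have m: "m \<ge> 2" using True assms by simp
  have 1: "k * (m choose k) = m * ((m - 1) choose (k - 1))"
    using True binomial_absorption[of "k - 1" m] by simp
  have "Suc (k - 2) = k - 1" using True by auto
  then have 2: "(k - 1) * ((m - 1) choose (k - 1)) = (m - 1) * ((m - 2) choose (k - 2))"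
    using binomial_absorption[of "k - 2" "m - 1"] by (simp add: numeral_2_eq_2)
  have "m * (m - 1) * ((m - 2) choose (k - 2)) = k * (k - 1) * (m choose k)"
  proof -
    have "m * (m - 1) * ((m - 2) choose (k - 2)) = (k - 1) * (m * ((m - 1) choose (k - 1)))"
      using 2 by (simp only: mult_ac)
    then show ?thesis by (simp only: 1[symmetric]) (simp only: mult_ac)
  qed
  then have "real (m * (m - 1) * ((m - 2) choose (k - 2))) = real (k * (k - 1) * (m choose k))" by simp
  then show ?thesis using True m by (simp add: c of_nat_diff)
next
  case False
  show ?thesis
  proof (cases "a < m \<and> b < m")
    case True
    then have k: "k < 2" using False by simp
    have "{J\<in>ksubsets m k. a \<in> J \<and> b \<in> J} = {}"
    proof -
      have False if "J \<in> ksubsets m k" "a \<in> J" "b \<in> J" for J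
      proof -
        have "J \<subseteq> {..<m}" "card J = k" using that(1) by (simp_all add: ksubsets_def)
        then have "card {a, b} \<le> k" using card_mono[of J "{a, b}"] that finite_subset by blast
        then show False using assms k by simp
      qed
      then show ?thesis by blast
    qed
    moreover have "k = 0 \<or> k = 1" using k by auto
    ultimately show ?thesis by auto
  next
    case False
    then have "{J\<in>ksubsets m k. a \<in> J \<and> b \<in> J} = {}" by (auto simp: ksubsets_def)
    then show ?thesis using False by auto
  qed
qed

lemma sum_ksubsets_weights:
  assumes "a \<noteq> b" "m \<ge> 2"
  shows "(\<Sum>J\<in>ksubsets m k. (1 - of_bool (a \<in> J) / 2) * (1 - of_bool (b \<in> J) / 2))
   = real (m choose k) * (1 - real k / (2 * real m) * (of_bool (a < m) + of_bool (b < m))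
      + of_bool (a < m) * of_bool (b < m) * (real k * (real k - 1) / (4 * real m * (real m - 1))))"
proof -
  \<comment> \<open>Only products and inverses are rearranged, and
    \<open>inverse_mult_distrib\<close> has no side conditions, so no denominator has to be
    cleared.\<close>
  have aux: "C - x * K * C / M / 2 - y * K * C / M / 2 + x * y * K * K' * C / (M * M') / 4
    = C * (1 - K / (2 * M) * (x + y) + x * y * (K * K' / (4 * M * M')))"
    for C x y K K' M M' :: real
  proof -
    have 1: "t * K * C / M / 2 = C * (K / (2 * M) * t)" for t
      by (simp only: divide_inverse inverse_mult_distrib mult_ac)
    have 2: "x * y * K * K' * C / (M * M') / 4 = C * (x * y * (K * K' / (4 * M * M')))"
      by (simp only: divide_inverse inverse_mult_distrib mult_ac)
    show ?thesis unfolding 1 2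
      by (simp only: right_diff_distrib distrib_left mult_1_right diff_diff_eq add_ac)
  qed
  have "(\<Sum>J\<in>ksubsets m k. (1 - of_bool (a \<in> J) / 2) * (1 - of_bool (b \<in> J) / 2))
    = (\<Sum>J\<in>ksubsets m k. 1 - of_bool (a \<in> J) / 2 - of_bool (b \<in> J) / 2 + of_bool (a \<in> J \<and> b \<in> J) / (4::real))"
    by (intro sum.cong refl, rename_tac J, case_tac "a \<in> J"; case_tac "b \<in> J") simp_all
  also have "\<dots> = real (m choose k) - real (card {J\<in>ksubsets m k. a \<in> J}) / 2 - real (card {J\<in>ksubsets m k. b \<in> J}) / 2
      + real (card {J\<in>ksubsets m k. a \<in> J \<and> b \<in> J}) / 4"
    by (simp add: sum.distrib sum_subtractf sum_divide_distrib[symmetric] Int_def card_ksubsets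
        del: of_bool_conj)
  also have "real (card {J\<in>ksubsets m k. a \<in> J}) = of_bool (a < m) * real k * real (m choose k) / real m"
    using card_ksubsets_mem[of m k a] assms by (simp add: eq_divide_eq mult.commute)
  also have "real (card {J\<in>ksubsets m k. b \<in> J}) = of_bool (b < m) * real k * real (m choose k) / real m"
    using card_ksubsets_mem[of m k b] assms by (simp add: eq_divide_eq mult.commute)
  also have "real (card {J\<in>ksubsets m k. a \<in> J \<and> b \<in> J})
    = of_bool (a < m) * of_bool (b < m) * real k * (real k - 1) * real (m choose k) / (real m * (real m - 1))"
  proof -
    have "real m * (real m - 1) \<noteq> 0" using assms by simp
    then show ?thesis using card_ksubsets_mem2[OF assms(1), of m k] by (simp add: eq_divide_eq mult.commute)
  qed
  also have "real (m choose k) - of_bool (a < m) * real k * real (m choose k) / real m / 2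
      - of_bool (b < m) * real k * real (m choose k) / real m / 2
      + of_bool (a < m) * of_bool (b < m) * real k * (real k - 1) * real (m choose k) / (real m * (real m - 1)) / 4
    = real (m choose k) * (1 - real k / (2 * real m) * (of_bool (a < m) + of_bool (b < m))
      + of_bool (a < m) * of_bool (b < m) * (real k * (real k - 1) / (4 * real m * (real m - 1))))"
    by (rule aux)
  finally show ?thesis .
qed

section \<open>Averaging over the rotations of a cycle\<close>

definition rot_pos :: "nat \<Rightarrow> nat \<Rightarrow> nat \<Rightarrow> nat" where
  "rot_pos n i r = (if r \<le> i then i - r else i + n - r)"

lemma rot_pos_less: "i < n \<Longrightarrow> r < n \<Longrightarrow> rot_pos n i r < n"
  by (auto simp: rot_pos_def)

lemma add_rot_pos_mod: "i < n \<Longrightarrow> r < n \<Longrightarrow> (r + rot_pos n i r) mod n = i"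
  by (auto simp: rot_pos_def)

text \<open>For fixed i the map \<open>rot_pos n i\<close> is an involution of the positions below
  n, so a fixed entry visits every position exactly once.\<close>

lemma sum_rot_pos: "i < n \<Longrightarrow> (\<Sum>r<n. f (rot_pos n i r)) = (\<Sum>t<n. f t)"
  by (rule sum.reindex_bij_witness[of _ "rot_pos n i" "rot_pos n i"]) (auto simp: rot_pos_def)

lemma nth_rotate_rot_pos:
  "i < length xs \<Longrightarrow> r < length xs \<Longrightarrow> rotate r xs ! rot_pos (length xs) i r = xs ! i"
  by (simp add: nth_rotate rot_pos_less add_rot_pos_mod)

lemma cyc_edge_rotate_rot_pos:
  assumes "i < length xs" "r < length xs"
  shows "cyc_edge (rotate r xs) (rot_pos (length xs) i r) = cyc_edge xs i"
proof -
  have "cyc_edge (rotate r xs) (rot_pos (length xs) i r) = cyc_edge xs (r + rot_pos (length xs) i r)"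
    using assms by (intro cyc_edge_rotate) auto
  also have "\<dots> = cyc_edge xs ((r + rot_pos (length xs) i r) mod length xs)"
    by (rule cyc_edge_mod[symmetric])
  finally show ?thesis by (simp only: add_rot_pos_mod assms)
qed

text \<open>After division by the total mass \<open>n * (m choose k) * matching_count V k\<close>,
  with m the size of a maximum matching, this is the e-coordinate of the mean of y.\<close>

definition weight :: "'a set \<Rightarrow> nat \<Rightarrow> 'a list \<Rightarrow> 'a set \<Rightarrow> real" where
  "weight V k xs e = (\<Sum>r<card V. \<Sum>J\<in>ksubsets (card V div 2) k.
     ham_count V (insert e (pairing (rotate r xs) J)))"

definition matching_count :: "'a set \<Rightarrow> nat \<Rightarrow> real" where
  "matching_count V k = ham_count V {} * (\<Prod>i<k. 2 / (real (card V) - 1 - real i))"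

text \<open>The coordinates outside x of the mean of y, where the last factor is the probability that
  S covers two fixed vertices of the matching, divided by 4.\<close>
definition noncycle_ratio :: "nat \<Rightarrow> nat \<Rightarrow> real" where
  "noncycle_ratio n k = (let m = real (n div 2) in
     2 / (real n * (real n - 1 - real k)) *
     (real n - 2 * real k + (4 * m - real n) * (real k * (real k - 1) / (4 * m * (m - 1)))))"

context
  fixes V :: "'a set" and k n m :: nat
  assumes V: "finite V" "card V = n" "n \<ge> 4" and km: "k \<le> m" and m_def: "m = n div 2"
begin

lemma perm_listD:
  assumes "xs \<in> permutations_of_set V"
  shows "distinct xs" "set xs = V" "length xs = n"
  using assms V by (auto simp: permutations_of_set_def length_finite_permutations_of_set distinct_card)

lemma rotate_perm_list: "xs \<in> permutations_of_set V \<Longrightarrow> rotate r xs \<in> permutations_of_set V"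
  by (auto simp: permutations_of_set_def)

lemma ksubsetsD:
  assumes "ys \<in> permutations_of_set V" "J \<in> ksubsets m k"
  shows "J \<subseteq> {..<length ys div 2}" "card J = k"
  using assms perm_listD[OF assms(1)] by (auto simp: ksubsets_def m_def)

lemma pairing_matching:
  assumes "ys \<in> permutations_of_set V" "J \<in> ksubsets m k"
  shows "matching V (pairing ys J)" "card (pairing ys J) = k"
  using matching_pairing[of ys J] card_pairing[of ys J] perm_listD[OF assms(1)] ksubsetsD[OF assms] by auto

lemma ham_count_pairing:
  assumes "ys \<in> permutations_of_set V" "J \<in> ksubsets m k"
  shows "ham_count V (pairing ys J) = matching_count V k"
  using ham_count_matching[OF V(1) _ pairing_matching(1)[OF assms]] V km
  by (simp add: pairing_matching(2)[OF assms] matching_count_def m_def)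

text \<open>The right side depends on the positions i and j only, not on the entries of
  \<open>ys\<close>; this is what makes the average over rotations computable.\<close>

lemma ham_count_pairing_insert:
  assumes ys: "ys \<in> permutations_of_set V" and J: "J \<in> ksubsets m k" and ij: "i < n" "j < n" "i \<noteq> j"
  shows "ham_count V (insert {ys ! i, ys ! j} (pairing ys J)) =
    (if i div 2 = j div 2 \<and> i div 2 \<in> J then matching_count V k
     else 2 * matching_count V k / (real n - 1 - real k) *
       ((1 - of_bool (i div 2 \<in> J) / 2) * (1 - of_bool (j div 2 \<in> J) / 2)))"
proof -
  note d = perm_listD[OF ys]
  note J' = ksubsetsD(1)[OF ys J]
  have mem: "{ys ! i, ys ! j} \<in> pairing ys J \<longleftrightarrow> i div 2 = j div 2 \<and> i div 2 \<in> J"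
    using mem_pairing_iff[OF d(1) J'] ij d by simp
  show ?thesis
  proof (cases "i div 2 = j div 2 \<and> i div 2 \<in> J")
    case True
    then have "insert {ys ! i, ys ! j} (pairing ys J) = pairing ys J" using mem by blast
    then show ?thesis using ham_count_pairing[OF ys J] by (simp only: if_P[OF True])
  next
    case False
    have "real n - 1 - real k > 0" using km V by (simp add: m_def)
    moreover have "ys ! i \<in> V" "ys ! j \<in> V" "ys ! i \<noteq> ys ! j"
      using d ij by (auto simp: nth_eq_iff_index_eq)
    moreover have "2 * card (pairing ys J) \<le> card V" 
      using pairing_matching(2)[OF ys J] km V by (simp add: m_def)
    ultimately have "(real n - 1 - real k) * ham_count V (insert {ys ! i, ys ! j} (pairing ys J))
      = 2 * (1 - of_bool (i div 2 \<in> J) / 2) * (1 - of_bool (j div 2 \<in> J) / 2) * matching_count V k"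
      using ham_count_matching_extend[OF V(1) _ pairing_matching(1)[OF ys J], of "ys ! i" "ys ! j"]
        mem False V Union_pairing_iff[OF d(1) J', of i] Union_pairing_iff[OF d(1) J', of j] ij d
      by (simp add: pairing_matching(2)[OF ys J] ham_count_pairing[OF ys J] del: Union_iff)
    moreover have "X = 2 * c / D * (p * q)" if "D * X = 2 * p * q * c" "D > 0" for X c D p q :: real
      using that by (simp add: field_simps)
    ultimately show ?thesis
      unfolding if_not_P[OF False] using \<open>real n - 1 - real k > 0\<close> by blast
  qed
qed

lemma weight_noncycle:
  assumes xs: "xs \<in> permutations_of_set V" and ij: "i < n" "j < n" "i \<noteq> j" "{xs ! i, xs ! j} \<notin> cyc xs"
  shows "weight V k xs {xs ! i, xs ! j}
    = real n * real (m choose k) * matching_count V k * noncycle_ratio n k"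
proof -
  note d = perm_listD[OF xs]
  define ch where "ch t = (of_bool (t div 2 < m) :: real)" for t
  define c where "c = 2 * matching_count V k / (real n - 1 - real k)"
  define \<kappa> where "\<kappa> = real k * (real k - 1) / (4 * real m * (real m - 1))"
  define p where "p i r = rot_pos n i r" for i r
  have m2: "m \<ge> 2" using V by (simp add: m_def)
  have inner: "(\<Sum>J\<in>ksubsets m k. ham_count V (insert {xs ! i, xs ! j} (pairing (rotate r xs) J)))
     = c * real (m choose k) * (1 - \<kappa> + (\<kappa> - real k / (2 * real m)) * (ch (p i r) + ch (p j r)))"
    if r: "r < n" for r
  proof -
    let ?ys = "rotate r xs"
    have ys: "?ys \<in> permutations_of_set V" using rotate_perm_list[OF xs] .
    have p: "p i r < n" "p j r < n" "?ys ! p i r = xs ! i" "?ys ! p j r = xs ! j"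
      unfolding p_def using ij r nth_rotate_rot_pos[of _ xs r] d by (auto simp: rot_pos_less)
    have "xs ! i \<noteq> xs ! j" using ij d by (simp add: nth_eq_iff_index_eq)
    then have pne: "p i r \<noteq> p j r" using p by metis
    \<comment> \<open>Distinct positions in one pair are 2a and 2a + 1, hence consecutive, and would
      give an edge of the cycle.\<close>
    have div: "p i r div 2 \<noteq> p j r div 2"
    proof
      assume eq: "p i r div 2 = p j r div 2"
      define a where "a = p i r div 2"
      have "p i r = 2 * a \<and> p j r = Suc (2 * a) \<or> p j r = 2 * a \<and> p i r = Suc (2 * a)"
        using eq pne unfolding a_def by presburger
      then have "{?ys ! p i r, ?ys ! p j r} = {?ys ! (2 * a), ?ys ! Suc (2 * a)}" "Suc (2 * a) < n"
        using p by auto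
      then have "{xs ! i, xs ! j} = cyc_edge ?ys (2 * a)"
        using p d by (simp add: cyc_edge_def)
      then have "{xs ! i, xs ! j} \<in> cyc ?ys" by (simp add: cyc_def)
      then show False using ij(4) by (simp only: cyc_rotate)
    qed
    have "(\<Sum>J\<in>ksubsets m k. ham_count V (insert {xs ! i, xs ! j} (pairing ?ys J)))
      = (\<Sum>J\<in>ksubsets m k. c * ((1 - of_bool (p i r div 2 \<in> J) / 2) * (1 - of_bool (p j r div 2 \<in> J) / 2)))"
      using ham_count_pairing_insert[OF ys _ p(1,2) pne] div p by (intro sum.cong) (auto simp: c_def)
    also have "\<dots> = c * (real (m choose k) * (1 - real k / (2 * real m) * (ch (p i r) + ch (p j r))
        + ch (p i r) * ch (p j r) * \<kappa>))"
      unfolding sum_distrib_left[symmetric] sum_ksubsets_weights[OF div m2] ch_def \<kappa>_def ..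
    \<comment> \<open>The two pair indices differ, so at most one equals m and at least one factor
      is 1. This makes the product linear, and the sum over rotations then needs only the sum of
      each \<open>ch\<close>.\<close>
    also have "ch (p i r) * ch (p j r) = ch (p i r) + ch (p j r) - 1"
    proof -
      have "p i r div 2 \<le> m" "p j r div 2 \<le> m" using p by (auto simp: m_def div_le_mono)
      then have "p i r div 2 < m \<or> p j r div 2 < m" using div by auto
      then show ?thesis by (auto simp: ch_def)
    qed
    finally show ?thesis by (simp add: algebra_simps)
  qed
  have chsum: "(\<Sum>r<n. ch (p i r)) = 2 * real m" if "i < n" for i
  proof -
    have "(\<Sum>r<n. ch (p i r)) = (\<Sum>t<n. ch t)" unfolding p_def by (rule sum_rot_pos[OF that])
    also have "\<dots> = real (card {t\<in>{..<n}. t div 2 < m})" 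
      unfolding ch_def by (rule sum_of_bool_card) simp
    also have "{t\<in>{..<n}. t div 2 < m} = {..<2 * m}" by (auto simp: m_def)
    finally show ?thesis by simp
  qed
  have "weight V k xs {xs ! i, xs ! j}
    = (\<Sum>r<n. c * real (m choose k) * (1 - \<kappa> + (\<kappa> - real k / (2 * real m)) * (ch (p i r) + ch (p j r))))"
    unfolding weight_def V(2) m_def[symmetric] by (rule sum.cong[OF refl]) (simp add: inner)
  also have "\<dots> = c * real (m choose k) * (real n * (1 - \<kappa>) + (\<kappa> - real k / (2 * real m)) * (2 * real m + 2 * real m))"
    by (simp add: sum_distrib_left[symmetric] sum.distrib chsum ij)
  \<comment> \<open>\<open>4 * m - n\<close> is the number of rotations in which both vertices lie
    in the maximum matching: n for even n, n - 2 for odd n.\<close>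
  also have "real n * (1 - \<kappa>) + (\<kappa> - real k / (2 * real m)) * (2 * real m + 2 * real m)
     = real n - 2 * real k + (4 * real m - real n) * \<kappa>"
    using m2 by (simp add: algebra_simps)
  finally have "weight V k xs {xs ! i, xs ! j} = real (m choose k) * matching_count V k *
      (2 / (real n - 1 - real k) * (real n - 2 * real k + (4 * real m - real n) * \<kappa>))"
    by (simp add: c_def)
  also have "2 / (real n - 1 - real k) * (real n - 2 * real k + (4 * real m - real n) * \<kappa>)
      = real n * noncycle_ratio n k"
    unfolding noncycle_ratio_def Let_def m_def[symmetric] \<kappa>_def using V(3) by simp
  finally show ?thesis by (simp only: mult_ac)
qed

text \<open>The contribution of a rotation is a function \<psi> of the position where the edge
  lands, and every edge of the cycle lands once at each position.\<close>

lemma weight_cycle_edges: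
  assumes xs: "xs \<in> permutations_of_set V" and e: "e \<in> cyc xs" and e': "e' \<in> cyc xs"
  shows "weight V k xs e = weight V k xs e'"
proof -
  note d = perm_listD[OF xs]
  define \<psi> where "\<psi> t = (\<Sum>J\<in>ksubsets m k. ham_count V (insert (cyc_edge xs t) (pairing xs J)))" for t
  have indep: "(\<Sum>J\<in>ksubsets m k. ham_count V (insert (cyc_edge ys t) (pairing ys J))) = \<psi> t"
    if ys: "ys \<in> permutations_of_set V" and t: "t < n" for ys t
  proof -
    have t': "Suc t mod n < n" "t \<noteq> Suc t mod n" using V t by (auto simp: mod_Suc)
    show ?thesis unfolding \<psi>_def
      using ham_count_pairing_insert[OF ys _ t t'] ham_count_pairing_insert[OF xs _ t t']
      by (intro sum.cong) (simp_all add: cyc_edge_def d perm_listD[OF ys] t)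
  qed
  have "weight V k xs (cyc_edge xs i) = (\<Sum>t<n. \<psi> t)" if i: "i < n" for i
  proof -
    have "weight V k xs (cyc_edge xs i) = (\<Sum>r<n. \<psi> (rot_pos n i r))"
      unfolding weight_def V(2) m_def[symmetric]
    proof (rule sum.cong[OF refl])
      fix r assume "r \<in> {..<n}"
      then have r: "r < n" by simp
      have "cyc_edge xs i = cyc_edge (rotate r xs) (rot_pos n i r)"
        using cyc_edge_rotate_rot_pos[of i xs r] i r d by simp
      then show "(\<Sum>J\<in>ksubsets m k. ham_count V (insert (cyc_edge xs i) (pairing (rotate r xs) J)))
        = \<psi> (rot_pos n i r)"
        using indep[OF rotate_perm_list[OF xs] rot_pos_less[OF i r], of r] by simp
    qed
    then show ?thesis using sum_rot_pos[OF i] by simp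
  qed
  moreover have "\<exists>i<n. f = cyc_edge xs i" if "f \<in> cyc xs" for f
    using that d V(3) cyc_eq[of xs] by (cases "xs = []") auto
  ultimately show ?thesis using e e' by metis
qed

lemma sum_weight:
  assumes xs: "xs \<in> permutations_of_set V"
  shows "(\<Sum>e\<in>{e. e \<subseteq> V \<and> card e = 2}. weight V k xs e)
    = real n * (real n * real (m choose k) * matching_count V k)"
proof -
  let ?E = "{e. e \<subseteq> V \<and> card e = 2}"
  have "(\<Sum>e\<in>?E. weight V k xs e)
    = (\<Sum>r<n. \<Sum>J\<in>ksubsets m k. \<Sum>e\<in>?E. ham_count V (insert e (pairing (rotate r xs) J)))"
    unfolding weight_def V(2) m_def[symmetric]
    by (subst sum.swap, rule sum.cong[OF refl], rule sum.swap)
  also have "\<dots> = (\<Sum>r<n. \<Sum>J\<in>ksubsets m k. real n * matching_count V k)"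
    using V by (intro sum.cong refl)
      (simp add: sum_ham_count_insert ham_count_pairing rotate_perm_list[OF xs])
  finally show ?thesis by (simp add: card_ksubsets)
qed

lemma card_pairs: "real (card {e. e \<subseteq> V \<and> card e = 2}) = real n * (real n - 1) / 2"
proof -
  have "2 * (n choose 2) = n * (n - 1)"
    unfolding choose_two by (rule dvd_mult_div_cancel) (cases n, auto)
  then have "2 * card {e. e \<subseteq> V \<and> card e = 2} = n * (n - 1)"
    using n_subsets[OF V(1), of 2] V(2) by simp
  then have "real (2 * card {e. e \<subseteq> V \<and> card e = 2}) = real (n * (n - 1))" by (simp only:)
  then show ?thesis using V(3) by (simp add: of_nat_diff)
qed

text \<open>The number b is chosen so that the coordinate 2 * (1 - b) / (n - 1) outside the cycle
  equals the known ratio. The value on the cycle is never computed directly: it follows from the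
  total weight over all edges, divided equally among the n edges of the cycle.\<close>

lemma weight_eq:
  assumes xs: "xs \<in> permutations_of_set V" and e: "e \<subseteq> V" "card e = 2"
  defines "b \<equiv> 1 - noncycle_ratio n k * (real n - 1) / 2"
  shows "weight V k xs e = real n * real (m choose k) * matching_count V k *
     (2 / (real n - 1) + b * (of_bool (e \<in> cyc xs) - 2 / (real n - 1)))"
proof -
  note d = perm_listD[OF xs]
  let ?E = "{e. e \<subseteq> V \<and> card e = 2}"
  define \<tau> where "\<tau> = real n * real (m choose k) * matching_count V k"
  define \<beta> where "\<beta> = noncycle_ratio n k"
  have finE: "finite ?E" using V(1) by simp
  have non: "weight V k xs f = \<tau> * \<beta>" if f: "f \<in> ?E - cyc xs" for f
  proof -
    obtain u v where uv: "f = {u, v}" "u \<noteq> v" "u \<in> V" "v \<in> V" using f by (auto simp: card_2_iff)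
    then obtain i j where "i < n" "j < n" "u = xs ! i" "v = xs ! j"
      using d by (metis in_set_conv_nth)
    then show ?thesis using weight_noncycle[OF xs, of i j] uv f by (auto simp: \<tau>_def \<beta>_def)
  qed
  show ?thesis
  proof (cases "e \<in> cyc xs")
    case False
    then have "weight V k xs e = \<tau> * \<beta>" using e non by simp
    moreover have "\<beta> = 2 / (real n - 1) + b * (of_bool (e \<in> cyc xs) - 2 / (real n - 1))"
    proof -
      have "\<beta> = 2 / x + (1 - \<beta> * x / 2) * (0 - 2 / x)" if "x \<noteq> 0" for x
        using that by (simp add: field_simps)
      from this[of "real n - 1"] show ?thesis using V(3) False by (simp add: b_def \<beta>_def[symmetric])
    qed
    ultimately show ?thesis unfolding \<tau>_def[symmetric] by (simp only:)
  next
    case True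
    have sub: "cyc xs \<subseteq> ?E"
    proof
      fix f assume "f \<in> cyc xs"
      then obtain i where "f = cyc_edge xs i" by (auto simp: cyc_def)
      then show "f \<in> ?E" using cyc_edge_pair[of xs i] d V(3) by auto
    qed
    have cc: "card (cyc xs) = n" using card_cyc[of xs] d V(3) by simp
    have fin: "finite (cyc xs)" using finite_subset[OF sub finE] .
    have "real n * \<tau> = (\<Sum>f\<in>?E. weight V k xs f)" using sum_weight[OF xs] by (simp add: \<tau>_def)
    also have "\<dots> = (\<Sum>f\<in>?E - cyc xs. weight V k xs f) + (\<Sum>f\<in>cyc xs. weight V k xs f)"
      by (rule sum.subset_diff[OF sub finE])
    also have "(\<Sum>f\<in>?E - cyc xs. weight V k xs f) = real (card (?E - cyc xs)) * (\<tau> * \<beta>)"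
      using non by simp
    also have "(\<Sum>f\<in>cyc xs. weight V k xs f) = real n * weight V k xs e"
      using weight_cycle_edges[OF xs _ True] by (simp add: cc)
    also have "real (card (?E - cyc xs)) = real n * (real n - 1) / 2 - real n"
      using card_Diff_subset[OF fin sub] card_mono[OF finE sub] card_pairs by (simp add: cc of_nat_diff)
    finally have "real n * weight V k xs e = real n * (\<tau> * (1 - ((real n - 1) / 2 - 1) * \<beta>))"
      by (simp add: algebra_simps)
    then have "weight V k xs e = \<tau> * (1 - ((real n - 1) / 2 - 1) * \<beta>)" using V(3) by simp
    also have "1 - ((real n - 1) / 2 - 1) * \<beta> = 2 / (real n - 1) + b * (1 - 2 / (real n - 1))"
    proof -
      have "1 - (x / 2 - 1) * \<beta> = 2 / x + (1 - \<beta> * x / 2) * (1 - 2 / x)" if "x \<noteq> 0" for x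
        using that by (simp add: field_simps)
      from this[of "real n - 1"] show ?thesis using V(3) by (simp add: b_def \<beta>_def[symmetric])
    qed
    finally show ?thesis using True by (simp add: \<tau>_def)
  qed
qed

end

text \<open>The parity of n enters through \<open>n div 2\<close> and changes only the formula for
  D. The common lower bound on D is attained in both cases at the largest k, which is what allows
  one estimate of \<alpha> for both.\<close>

lemma noncycle_ratio_inverse:
  fixes n k :: nat
  assumes n: "n \<ge> 9" and k: "1 \<le> k" "k \<le> n div 2"
  defines "b \<equiv> 1 - noncycle_ratio n k * (real n - 1) / 2"
  shows "\<exists>\<alpha>. \<bar>\<alpha>\<bar> \<le> 10 / real n \<and> b * (real n / real k + \<alpha>) = 1"
proof -
  define N where "N = real n"
  define K where "K = real k"
  have N: "N \<ge> 9" and K: "K \<ge> 1" "2 * K \<le> N" using assms by (auto simp: N_def K_def)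
  have bound: "\<bar>N / K * ((K - 1) / D)\<bar> \<le> 10 / N" if D: "D \<ge> (N - 2) * (N - 3) / 2" for D
  proof -
    have "(N - 2) * (N - 3) \<ge> 7 * 6" using N by (intro mult_mono) auto
    then have D0: "D > 0" using D by linarith
    have 1: "N * N \<le> 10 * D"
    proof -
      \<comment> \<open>This is 4 * N^2 - 25 * N + 30 \<ge> 0, divided by N - 9 with remainder so
        that the sign is visible for N \<ge> 9.\<close>
      have "0 \<le> (N - 9) * (4 * N + 11) + 129" using N by (intro add_nonneg_nonneg mult_nonneg_nonneg) auto
      then have "N * N \<le> 10 * ((N - 2) * (N - 3) / 2)" by (simp add: algebra_simps)
      then show ?thesis using D by linarith
    qed
    have "(K - 1) / K \<le> 1" using K by simp
    then have "(K - 1) / K * (N * N) \<le> 1 * (10 * D)"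
      by (rule mult_mono[OF _ 1]) (use N in auto)
    then have "N / K * ((K - 1) / D) \<le> 10 / N"
      using D0 N K by (simp add: field_simps)
    moreover have "N / K * ((K - 1) / D) \<ge> 0" using D0 N K by simp
    ultimately show ?thesis by simp
  qed
  show ?thesis
  proof (cases "even n")
    case True
    then have m: "real (n div 2) = N / 2" by (auto simp: N_def)
    define D where "D = (N - 2)\<^sup>2 - (N - 1) * (K - 1)"
    have "(N - 1) * (K - 1) \<le> (N - 1) * (N / 2 - 1)" using N K by (intro mult_left_mono) auto
    then have D: "D \<ge> (N - 2) * (N - 3) / 2"
      by (simp add: D_def power2_eq_square field_simps)
    have D0: "D > 0"
    proof -
      have "(N - 2) * (N - 3) \<ge> 7 * 6" using N by (intro mult_mono) auto
      then show ?thesis using D by linarith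
    qed
    have nz: "N - 1 - K > 0" "N - 2 > 0" using N K by auto
    have "noncycle_ratio n k = 2 / (N * (N - 1 - K)) * (N - 2 * K + N * (K * (K - 1) / (N * (N - 2))))"
      unfolding noncycle_ratio_def Let_def m N_def[symmetric] K_def[symmetric] using N
      by (simp add: algebra_simps)
    also have "N * (K * (K - 1) / (N * (N - 2))) = K * (K - 1) / (N - 2)" using N by simp
    finally have "b = 1 - 2 / (N * (N - 1 - K)) * (N - 2 * K + K * (K - 1) / (N - 2)) * (N - 1) / 2"
      unfolding b_def N_def[symmetric] by (simp only:)
    also have "\<dots> = (N * (N - 1 - K) * (N - 2) - ((N - 2 * K) * (N - 2) + K * (K - 1)) * (N - 1))
        / (N * (N - 1 - K) * (N - 2))"
    proof -
      have "1 - 2 / (N * P) * (X + c / Q) * y / 2 = (N * P * Q - (X * Q + c) * y) / (N * P * Q)"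
        if "P > 0" "Q > 0" for P Q X c y
        using that N by (simp add: field_simps)
      then show ?thesis using nz by blast
    qed
    \<comment> \<open>The terms free of K cancel, which is why b carries the factor K / N and 1 / b
      is close to N / K.\<close>
    also have "N * (N - 1 - K) * (N - 2) - ((N - 2 * K) * (N - 2) + K * (K - 1)) * (N - 1) = K * D"
      by (simp add: D_def power2_eq_square algebra_simps)
    finally have "b = K / N * (D / ((N - 2) * (N - 1 - K)))" by (simp add: mult_ac)
    \<comment> \<open>Origin of the witness: 1 / b is N / K times a quotient whose numerator exceeds
      its denominator D by exactly K - 1.\<close>
    moreover have "N / K + N / K * ((K - 1) / D) = N / K * ((N - 2) * (N - 1 - K) / D)"
    proof -
      have "1 + (K - 1) / D = (D + (K - 1)) / D" using D0 by (simp add: add_divide_distrib)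
      also have "D + (K - 1) = (N - 2) * (N - 1 - K)"
        by (simp add: D_def power2_eq_square algebra_simps)
      finally have "N / K * (1 + (K - 1) / D) = N / K * ((N - 2) * (N - 1 - K) / D)" by (simp only:)
      then show ?thesis by (simp only: distrib_left mult_1_right)
    qed
    ultimately have "b * (N / K + N / K * ((K - 1) / D)) = 1"
      using nz D0 N K by simp
    then show ?thesis using bound[OF D] unfolding N_def[symmetric] K_def[symmetric] by blast
  next
    case False
    then have m: "real (n div 2) = (N - 1) / 2" by (auto simp: N_def elim!: oddE)
    \<comment> \<open>Integrality of k gains one half over K \<le> N / 2; the bound N - K - 2 \<ge>
      (N - 3) / 2 rests on it.\<close>
    have K': "2 * K \<le> N - 1" using assms(3) False by (auto simp: N_def K_def elim!: oddE)
    define D where "D = (N - 2) * (N - K - 2)"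
    have "(N - 2) * ((N - 3) / 2) \<le> D" unfolding D_def using N K' by (intro mult_left_mono) auto
    then have D: "D \<ge> (N - 2) * (N - 3) / 2" by simp
    have nz: "N - 1 - K > 0" "N - 2 > 0" "N - 3 > 0" "N - K - 2 > 0" using N K by auto
    have D0: "D > 0" using nz by (simp add: D_def)
    have ratio: "noncycle_ratio n k = 2 / (N * (N - 1 - K)) * (N - 2 * K + (N - 2) * (K * (K - 1) / ((N - 1) * (N - 3))))"
    proof -
      have 1: "4 * ((N - 1) / 2) - N = N - 2" by simp
      have 2: "4 * ((N - 1) / 2) * ((N - 1) / 2 - 1) = (N - 1) * (N - 3)" by (simp add: field_simps)
      show ?thesis unfolding noncycle_ratio_def Let_def m N_def[symmetric] K_def[symmetric] 1 2
        by (rule refl)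
    qed
    have "b = 1 - 2 / (N * (N - 1 - K)) * (N - 2 * K + (N - 2) * (K * (K - 1) / ((N - 1) * (N - 3)))) * (N - 1) / 2"
      unfolding b_def N_def[symmetric] ratio by (rule refl)
    also have "\<dots> = (N * (N - 1 - K) * (N - 3) - ((N - 2 * K) * (N - 3) * (N - 1) + (N - 2) * (K * (K - 1))))
        / (N * (N - 1 - K) * (N - 3))"
    proof -
      have "1 - 2 / (N * P) * (X + z * (c / (y * Q))) * y / 2 = (N * P * Q - (X * Q * y + z * c)) / (N * P * Q)"
        if "P > 0" "Q > 0" "y > 0" for P Q X c y z
        using that N by (simp add: field_simps)
      moreover have "N - 1 > 0" using N by simp
      ultimately show ?thesis using nz by blast
    qed
    also have "N * (N - 1 - K) * (N - 3) - ((N - 2 * K) * (N - 3) * (N - 1) + (N - 2) * (K * (K - 1))) = K * D"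
      by (simp add: D_def algebra_simps)
    finally have "b = K / N * (D / ((N - 3) * (N - 1 - K)))" by (simp add: mult_ac)
    moreover have "N / K + N / K * ((K - 1) / D) = N / K * ((N - 3) * (N - 1 - K) / D)"
    proof -
      have "1 + (K - 1) / D = (D + (K - 1)) / D" using D0 by (simp add: add_divide_distrib)
      also have "D + (K - 1) = (N - 3) * (N - 1 - K)" by (simp add: D_def algebra_simps)
      finally have "N / K * (1 + (K - 1) / D) = N / K * ((N - 3) * (N - 1 - K) / D)" by (simp only:)
      then show ?thesis by (simp only: distrib_left mult_1_right)
    qed
    ultimately have "b * (N / K + N / K * ((K - 1) / D)) = 1"
      using nz D0 N K by simp
    then show ?thesis using bound[OF D] unfolding N_def[symmetric] K_def[symmetric] by blast
  qed
qed

section \<open>The polytope and its relaxation\<close>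

text \<open>Induction on the number of generators: if v i is needed, shift everything along a functional c0
  that is nonnegative on the other generators but negative on z, making v i vanish.\<close>
lemma farkas:
  fixes v :: "'i \<Rightarrow> 'e \<Rightarrow> real"
  assumes "finite I" "finite E"
    and "\<And>c :: 'e \<Rightarrow> real. (\<And>i. i \<in> I \<Longrightarrow> 0 \<le> (\<Sum>e\<in>E. c e * v i e)) \<Longrightarrow> 0 \<le> (\<Sum>e\<in>E. c e * z e)"
  shows "\<exists>u. (\<forall>i\<in>I. 0 \<le> u i) \<and> (\<forall>e\<in>E. z e = (\<Sum>i\<in>I. u i * v i e))"
  using assms(1,3)
proof (induction I arbitrary: v z rule: finite_induct)
  case empty
  \<comment> \<open>Without generators every c is admissible, and c = - z forces z to vanish on
    E.\<close>
  have "0 \<le> (\<Sum>e\<in>E. (- z e) * z e)" by (rule empty.prems) simp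
  then have "(\<Sum>e\<in>E. z e * z e) \<le> 0" by (simp add: sum_negf)
  then have "(\<Sum>e\<in>E. z e * z e) = 0" by (intro antisym sum_nonneg) auto
  then have "\<forall>e\<in>E. z e * z e = 0" using assms(2) by (subst (asm) sum_nonneg_eq_0_iff) auto
  then show ?case by auto
next
  case (insert j I)
  define ip where "ip c x = (\<Sum>e\<in>E. c e * x e)" for c x :: "'e \<Rightarrow> real"
  have ip_lin: "ip c (\<lambda>e. x e + t * y e) = ip c x + t * ip c y"
    "ip (\<lambda>e. x e + t * y e) c = ip x c + t * ip y c" for c x y t
    by (simp_all add: ip_def algebra_simps sum.distrib sum_distrib_left)
  have prem: "0 \<le> ip c z" if "\<And>i. i \<in> insert j I \<Longrightarrow> 0 \<le> ip c (v i)" for c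
    using insert.prems[of c] that by (simp add: ip_def)
  show ?case
  proof (cases "\<forall>c. (\<forall>i\<in>I. 0 \<le> ip c (v i)) \<longrightarrow> 0 \<le> ip c z")
    case True
    then obtain u where u: "\<forall>i\<in>I. 0 \<le> u i" "\<forall>e\<in>E. z e = (\<Sum>i\<in>I. u i * v i e)"
      using insert.IH[of v z] by (auto simp: ip_def)
    have "(\<Sum>i\<in>insert j I. (u(j := 0)) i * v i e) = (\<Sum>i\<in>I. u i * v i e)" for e
      using insert.hyps by (auto intro!: sum.cong)
    then show ?thesis using u by (intro exI[of _ "u(j := 0)"]) auto
  next
    case False
    then obtain c0 where c0: "\<forall>i\<in>I. 0 \<le> ip c0 (v i)" "ip c0 z < 0" by force
    then have neg: "ip c0 (v j) < 0" using prem[of c0] by force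
    define d where "d = - ip c0 (v j)"
    have d: "d > 0" using neg by (simp add: d_def)
    \<comment> \<open>\<open>sh\<close> is the projection along \<open>v j\<close> onto the kernel
      of \<open>ip c0\<close>; each other generator changes by a nonnegative multiple of
      \<open>v j\<close>.\<close>
    define sh where "sh x = (\<lambda>e. x e + ip c0 x / d * v j e)" for x
    have sh: "ip c (sh x) = ip (\<lambda>e. c e + ip c (v j) / d * c0 e) x" for c x
      unfolding sh_def ip_lin by (simp add: mult.commute)
    have "\<exists>u. (\<forall>i\<in>I. 0 \<le> u i) \<and> (\<forall>e\<in>E. sh z e = (\<Sum>i\<in>I. u i * sh (v i) e))"
    proof (rule insert.IH)
      fix c assume c: "\<And>i. i \<in> I \<Longrightarrow> 0 \<le> (\<Sum>e\<in>E. c e * sh (v i) e)"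
      \<comment> \<open>This is the adjoint of the projection applied to c. It vanishes on
        \<open>v j\<close>, so the hypothesis for the larger family applies to it.\<close>
      define c' where "c' = (\<lambda>e. c e + ip c (v j) / d * c0 e)"
      have "ip c' (v j) = 0" unfolding c'_def ip_lin using d by (simp add: d_def)
      moreover have "0 \<le> ip c' (v i)" if "i \<in> I" for i
        using c[OF that] sh[of c "v i"] by (simp add: c'_def ip_def)
      ultimately have "0 \<le> ip c' z" by (intro prem) auto
      then show "0 \<le> (\<Sum>e\<in>E. c e * sh z e)" using sh[of c z] by (simp add: c'_def ip_def)
    qed
    then obtain u where u: "\<forall>i\<in>I. 0 \<le> u i" "\<forall>e\<in>E. sh z e = (\<Sum>i\<in>I. u i * sh (v i) e)" by blast
    \<comment> \<open>Undoing the projection collects these multiples of \<open>v j\<close>; the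
      last term has the right sign because \<open>ip c0 z\<close> is negative.\<close>
    define s where "s = (\<Sum>i\<in>I. u i * (ip c0 (v i) / d)) - ip c0 z / d"
    have "s \<ge> 0"
    proof -
      have "(\<Sum>i\<in>I. u i * (ip c0 (v i) / d)) \<ge> 0" using u c0 d by (intro sum_nonneg) simp
      moreover have "ip c0 z / d \<le> 0" using c0 d by (simp add: divide_le_0_iff)
      ultimately show ?thesis by (simp add: s_def)
    qed
    moreover have "z e = (\<Sum>i\<in>insert j I. (u(j := s)) i * v i e)" if "e \<in> E" for e
    proof -
      have "z e + ip c0 z / d * v j e = (\<Sum>i\<in>I. u i * v i e + u i * (ip c0 (v i) / d) * v j e)"
        using u(2) that by (simp add: sh_def algebra_simps)
      also have "\<dots> = (\<Sum>i\<in>I. u i * v i e) + (\<Sum>i\<in>I. u i * (ip c0 (v i) / d)) * v j e"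
        by (simp only: sum.distrib sum_distrib_right)
      finally have "z e = (\<Sum>i\<in>I. u i * v i e) + s * v j e" by (simp add: s_def left_diff_distrib)
      also have "(\<Sum>i\<in>I. u i * v i e) = (\<Sum>i\<in>I. (u(j := s)) i * v i e)"
        using insert.hyps by (intro sum.cong) auto
      finally show ?thesis using insert.hyps by simp
    qed
    ultimately show ?thesis using u(1) by (intro exI[of _ "u(j := s)"]) auto
  qed
qed

section \<open>Vertices of the polytope as orderings\<close>

abbreviation orderings :: "nat \<Rightarrow> nat list set" where
  "orderings n \<equiv> permutations_of_set {1..n}"

definition char_vec :: "nat set set \<Rightarrow> nat set \<Rightarrow> real" where
  "char_vec C = (\<lambda>e. of_bool (e \<in> C))"

lemma edges_eq: "edges n = {e. e \<subseteq> {1..n} \<and> card e = 2}"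
  unfolding edges_def card_2_iff by fast

lemma finite_edges [simp]: "finite (edges n)"
  unfolding edges_eq by (rule finite_subset[of _ "Pow {1..n}"]) auto

lemma orderingsD:
  assumes "xs \<in> orderings n"
  shows "distinct xs" "set xs = {1..n}" "length xs = n"
  using assms by (auto simp: permutations_of_set_def length_finite_permutations_of_set dest: distinct_card)

lemma ham_cycles_eq:
  assumes "n \<ge> 1"
  shows "ham_cycles n = cyc ` orderings n"
proof
  have cyc_lt: "cyc xs = {{xs ! i, xs ! ((i + 1) mod n)} |i. i < n}" if "length xs = n" for xs :: "nat list"
  proof -
    have "xs \<noteq> []" using that assms by auto
    then show ?thesis using that by (auto simp: cyc_eq cyc_edge_def)
  qed
  show "ham_cycles n \<subseteq> cyc ` orderings n"
  proof
    fix C assume "C \<in> ham_cycles n"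
    then obtain p where p: "bij_betw p {..<n} {1..n}" "C = {{p i, p ((i + 1) mod n)} | i. i < n}"
      unfolding ham_cycles_def by blast
    let ?xs = "map p [0..<n]"
    have "?xs \<in> orderings n"
      using p(1) by (auto simp: permutations_of_set_def bij_betw_def distinct_map lessThan_atLeast0)
    moreover have "cyc ?xs = C"
    proof -
      have "{?xs ! i, ?xs ! ((i + 1) mod n)} = {p i, p ((i + 1) mod n)}" if "i < n" for i
        using that by simp
      then show ?thesis unfolding p(2) by (subst cyc_lt) (simp, blast)
    qed
    ultimately show "C \<in> cyc ` orderings n" by blast
  qed
  show "cyc ` orderings n \<subseteq> ham_cycles n"
  proof
    fix C assume "C \<in> cyc ` orderings n"
    then obtain xs where xs: "xs \<in> orderings n" "C = cyc xs" by blast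
    have "bij_betw ((!) xs) {..<n} {1..n}"
      using bij_betw_nth[of xs "{..<n}" "{1..n}"] orderingsD[OF xs(1)] by simp
    then show "C \<in> ham_cycles n"
      unfolding ham_cycles_def xs(2) using cyc_lt[of xs] orderingsD[OF xs(1)] by blast
  qed
qed

lemma cyc_map: "xs \<noteq> [] \<Longrightarrow> cyc (map \<pi> xs) = image \<pi> ` cyc xs"
  by (simp add: cyc_eq image_image cyc_edge_def)

text \<open>The relabelling that carries \<open>xs\<close> to \<open>ys\<close> maps the orderings
  of one cycle injectively to those of the other. Used in both directions it gives equal
  multiplicities without computing them.\<close>

lemma card_fibre_le:
  assumes xs: "xs \<in> permutations_of_set V" and ys: "ys \<in> permutations_of_set V" and V: "V \<noteq> {}"
  shows "card {zs \<in> permutations_of_set V. cyc zs = cyc xs} \<le> card {zs \<in> permutations_of_set V. cyc zs = cyc ys}"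
proof -
  let ?L = "permutations_of_set V" and ?n = "length xs"
  have d: "distinct xs" "distinct ys" "set xs = V" "set ys = V"
    using assms by (auto simp: permutations_of_set_def)
  have len: "length ys = ?n" using d by (metis distinct_card)
  define \<pi> where "\<pi> = (\<lambda>v. ys ! inv_into {..<?n} ((!) xs) v)"
  have bx: "bij_betw ((!) xs) {..<?n} V" and byy: "bij_betw ((!) ys) {..<?n} V"
    using bij_betw_nth[of xs "{..<?n}" V] bij_betw_nth[of ys "{..<?n}" V] d len by auto
  have "bij_betw ((!) ys \<circ> inv_into {..<?n} ((!) xs)) V V"
    using bij_betw_trans[OF bij_betw_inv_into[OF bx] byy] .
  then have bij: "bij_betw \<pi> V V" by (simp add: \<pi>_def comp_def)
  have map: "map \<pi> xs = ys"
  proof (rule nth_equalityI)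
    fix i assume "i < length (map \<pi> xs)"
    then have "i < ?n" by simp
    then show "map \<pi> xs ! i = ys ! i"
      using bij_betw_inv_into_left[OF bx, of i] by (simp add: \<pi>_def)
  qed (simp add: len)
  show ?thesis
  proof (rule card_inj_on_le[of "map \<pi>"])
    show "inj_on (map \<pi>) {zs \<in> ?L. cyc zs = cyc xs}"
      by (rule inj_on_subset[OF inj_on_map_lists[of \<pi> V]])
        (use bij in \<open>auto simp: bij_betw_def permutations_of_set_def\<close>)
    show "map \<pi> ` {zs \<in> ?L. cyc zs = cyc xs} \<subseteq> {zs \<in> ?L. cyc zs = cyc ys}"
    proof clarify
      fix zs assume zs: "zs \<in> ?L" "cyc zs = cyc xs"
      then have z: "distinct zs" "set zs = V" by (auto simp: permutations_of_set_def)
      have "zs \<noteq> []" "xs \<noteq> []" using V z d by auto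
      then have "cyc (map \<pi> zs) = cyc ys" using zs(2) by (metis cyc_map map)
      moreover have "map \<pi> zs \<in> ?L"
        using z bij by (auto simp: permutations_of_set_def distinct_map bij_betw_def)
      ultimately show "map \<pi> zs \<in> ?L \<and> cyc (map \<pi> zs) = cyc ys" by simp
    qed
  qed simp
qed

lemma tsp_vertices_eq: "n \<ge> 1 \<Longrightarrow> tsp_vertices n = (\<lambda>xs. char_vec (cyc xs)) ` orderings n"
  by (simp add: tsp_vertices_def ham_cycles_eq image_image char_vec_def of_bool_def)

lemma inj_char_vec: "inj char_vec"
proof
  fix C D assume "char_vec C = char_vec D"
  then have "of_bool (e \<in> C) = (of_bool (e \<in> D) :: real)" for e by (simp add: char_vec_def fun_eq_iff)
  then show "C = D" by (auto simp: of_bool_eq_iff)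
qed

lemma finite_tsp_vertices: "n \<ge> 1 \<Longrightarrow> finite (tsp_vertices n)"
  by (simp add: tsp_vertices_eq)

lemma tsp_vertices_nonempty: "n \<ge> 1 \<Longrightarrow> tsp_vertices n \<noteq> {}"
  by (simp add: tsp_vertices_eq permutations_of_set_empty_iff)

text \<open>Every Hamiltonian cycle comes from the same number of orderings, so averages over
  cycles may be computed over orderings.\<close>
lemma sum_orderings:
  assumes n: "n \<ge> 1"
  obtains \<mu> :: real where "\<mu> > 0"
    "\<And>G :: _ \<Rightarrow> real. (\<Sum>xs\<in>orderings n. G (char_vec (cyc xs))) = \<mu> * (\<Sum>x\<in>tsp_vertices n. G x)"
proof -
  let ?L = "orderings n"
  have "?L \<noteq> {}" by (simp add: permutations_of_set_empty_iff)
  then obtain xs0 where xs0: "xs0 \<in> ?L" by blast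
  define \<mu> where "\<mu> = card {zs\<in>?L. cyc zs = cyc xs0}"
  have \<mu>: "card {zs\<in>?L. char_vec (cyc zs) = char_vec (cyc xs)} = \<mu>" if "xs \<in> ?L" for xs
    unfolding \<mu>_def inj_eq[OF inj_char_vec] by (intro antisym card_fibre_le that xs0) (use n in auto)
  have "finite {zs\<in>?L. cyc zs = cyc xs0}" "{zs\<in>?L. cyc zs = cyc xs0} \<noteq> {}" using xs0 by auto
  then have "\<mu> > 0" unfolding \<mu>_def by (simp only: card_gt_0_iff simp_thms)
  moreover have "(\<Sum>xs\<in>?L. G (char_vec (cyc xs))) = real \<mu> * (\<Sum>x\<in>tsp_vertices n. G x)"
    for G :: "_ \<Rightarrow> real"
  proof -
    have "(\<Sum>xs\<in>?L. G (char_vec (cyc xs)))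
      = (\<Sum>y\<in>(\<lambda>xs. char_vec (cyc xs)) ` ?L. \<Sum>xs\<in>{xs\<in>?L. char_vec (cyc xs) = y}. G (char_vec (cyc xs)))"
      by (rule sum.image_gen) simp
    also have "\<dots> = (\<Sum>y\<in>(\<lambda>xs. char_vec (cyc xs)) ` ?L. real \<mu> * G y)"
    proof (rule sum.cong[OF refl])
      fix y assume "y \<in> (\<lambda>xs. char_vec (cyc xs)) ` ?L"
      then have "card {xs\<in>?L. char_vec (cyc xs) = y} = \<mu>" using \<mu> by blast
      moreover have "(\<Sum>xs\<in>{xs\<in>?L. char_vec (cyc xs) = y}. G (char_vec (cyc xs)))
        = (\<Sum>xs\<in>{xs\<in>?L. char_vec (cyc xs) = y}. G y)"
        by (rule sum.cong) auto
      ultimately show "(\<Sum>xs\<in>{xs\<in>?L. char_vec (cyc xs) = y}. G (char_vec (cyc xs))) = real \<mu> * G y"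
        by (simp only: sum_constant)
    qed
    finally show ?thesis by (simp add: tsp_vertices_eq[OF n] sum_distrib_left)
  qed
  ultimately show thesis using that[of "real \<mu>"] by auto
qed

lemma linfun_combination:
  assumes "finite I" "w = (\<lambda>e. \<Sum>i\<in>I. t i * v i e)"
  shows "linfun n c w = (\<Sum>i\<in>I. t i * linfun n c (v i))"
  unfolding linfun_def assms(2) sum_distrib_left
  by (subst sum.swap) (simp add: mult_ac)

lemma cyc_subset_edges:
  assumes "n \<ge> 3" "xs \<in> orderings n"
  shows "cyc xs \<subseteq> edges n"
  using assms cyc_edge_pair[of xs] orderingsD[OF assms(2)] unfolding edges_eq cyc_def by auto

lemma tsp_vertex_support:
  assumes "n \<ge> 3" "x \<in> tsp_vertices n" "e \<notin> edges n"
  shows "x e = 0"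
proof -
  obtain xs where xs: "xs \<in> orderings n" "x = char_vec (cyc xs)" using assms by (auto simp: tsp_vertices_eq)
  then show ?thesis using cyc_subset_edges[OF assms(1) xs(1)] assms(3) by (auto simp: char_vec_def)
qed

lemma tsp_vertex_sum:
  assumes "n \<ge> 3" "x \<in> tsp_vertices n"
  shows "(\<Sum>e\<in>edges n. x e) = real n"
proof -
  obtain xs where xs: "xs \<in> orderings n" "x = char_vec (cyc xs)" using assms by (auto simp: tsp_vertices_eq)
  have "{e \<in> edges n. e \<in> cyc xs} = cyc xs" using cyc_subset_edges[OF assms(1) xs(1)] by auto
  then show ?thesis
    using card_cyc[of xs] orderingsD[OF xs(1)] assms(1) by (simp add: xs(2) char_vec_def Int_def)
qed

text \<open>Farkas only yields a conical combination. It is convex because the sum of the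
  coordinates equals n on every vertex, and therefore also on the affine span, which contains
  z.\<close>

lemma P_polar_subset_tsp_polytope:
  assumes n: "n \<ge> 3"
  shows "P_polar n k \<subseteq> tsp_polytope n"
proof
  fix z assume z: "z \<in> P_polar n k"
  let ?X = "tsp_vertices n"
  have n1: "n \<ge> 1" using n by simp
  have finX: "finite ?X" and neX: "?X \<noteq> {}" using finite_tsp_vertices[OF n1] tsp_vertices_nonempty[OF n1] .
  then have cardX: "real (card ?X) > 0" by (simp add: card_gt_0_iff)
  from z obtain \<nu> where \<nu>: "(\<Sum>x\<in>?X. \<nu> x) = 1" "z = (\<lambda>e. \<Sum>x\<in>?X. \<nu> x * x e)"
    unfolding P_polar_def tsp_aff_def by blast
  have lin_z: "linfun n c z = (\<Sum>x\<in>?X. \<nu> x * linfun n c x)" for c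
    by (rule linfun_combination[OF finX \<nu>(2)])
  have "\<exists>u. (\<forall>x\<in>?X. 0 \<le> u x) \<and> (\<forall>e\<in>edges n. z e = (\<Sum>x\<in>?X. u x * x e))"
  proof (rule farkas[OF finX finite_edges])
    fix c :: "nat set \<Rightarrow> real"
    assume c: "0 \<le> (\<Sum>e\<in>edges n. c e * x e)" if "x \<in> ?X" for x
    then have c: "0 \<le> linfun n c x" if "x \<in> ?X" for x using that by (simp add: linfun_def)
    define A where "A = (1 / real (card ?X)) * (\<Sum>x\<in>?X. linfun n c x)"
    have "0 \<le> linfun n c z"
    \<comment> \<open>A nonnegative function of average 0 cannot be scaled into
      \<open>P_set\<close>, but it vanishes on all vertices and hence at z.\<close>
    proof (cases "A = 0")
      case True
      then have "(\<Sum>x\<in>?X. linfun n c x) = 0" using cardX by (simp add: A_def)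
      then have "\<forall>x\<in>?X. linfun n c x = 0" using finX c by (subst (asm) sum_nonneg_eq_0_iff) auto
      then show ?thesis by (simp add: lin_z)
    next
      case False
      moreover have "A \<ge> 0" unfolding A_def by (intro mult_nonneg_nonneg sum_nonneg c) auto
      ultimately have A: "A > 0" by simp
      define c' where "c' = (\<lambda>e. c e / A)"
      have c': "linfun n c' x = linfun n c x / A" for x
        by (simp add: linfun_def c'_def sum_divide_distrib)
      have "c' \<in> P_set n k"
        unfolding P_set_def q_form_def
      proof (intro CollectI conjI allI impI)
        have "(1 / real (card ?X)) * (\<Sum>x\<in>?X. linfun n c' x) = A / A"
          unfolding c' sum_divide_distrib[symmetric] A_def by simp
        then show "(1 / real (card ?X)) * (\<Sum>x\<in>?X. linfun n c' x) = 1" using A by simp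
      qed (use A c in \<open>auto simp: c' intro!: mult_nonneg_nonneg divide_nonneg_nonneg sum_nonneg\<close>)
      then have "0 \<le> linfun n c' z" using z by (auto simp: P_polar_def)
      then show ?thesis using A by (simp add: c' zero_le_divide_iff)
    qed
    then show "0 \<le> (\<Sum>e\<in>edges n. c e * z e)" by (simp add: linfun_def)
  qed
  then obtain u where u: "\<forall>x\<in>?X. 0 \<le> u x" "\<forall>e\<in>edges n. z e = (\<Sum>x\<in>?X. u x * x e)" by blast
  \<comment> \<open>Farkas speaks about the coordinates in \<open>edges n\<close> only; off these,
    both sides vanish.\<close>
  have zu: "z = (\<lambda>e. \<Sum>x\<in>?X. u x * x e)"
  proof
    fix e
    have "(\<Sum>x\<in>?X. t x * x e) = 0" if "e \<notin> edges n" for t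
      by (rule sum.neutral) (simp add: tsp_vertex_support[OF n _ that])
    then show "z e = (\<Sum>x\<in>?X. u x * x e)"
      using u(2) by (cases "e \<in> edges n") (simp_all add: \<nu>(2))
  qed
  have total: "(\<Sum>e\<in>edges n. z e) = real n * (\<Sum>x\<in>?X. t x)" if "z = (\<lambda>e. \<Sum>x\<in>?X. t x * x e)" for t
  proof -
    have "(\<Sum>e\<in>edges n. z e) = (\<Sum>x\<in>?X. t x * (\<Sum>e\<in>edges n. x e))"
      unfolding that sum_distrib_left by (rule sum.swap)
    then show ?thesis using tsp_vertex_sum[OF n] by (simp add: sum_distrib_left mult.commute)
  qed
  have "(\<Sum>x\<in>?X. u x) = 1" using total[OF zu] total[OF \<nu>(2)] \<nu>(1) n by simp
  then show "z \<in> tsp_polytope n" using u(1) zu unfolding tsp_polytope_def by blast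
qed

section \<open>Squared monomials as test polynomials\<close>

lemma finite_bounded_multisets:
  assumes "finite E"
  shows "finite {S. set_mset S \<subseteq> E \<and> size S \<le> k}"
proof (rule finite_subset)
  show "{S. set_mset S \<subseteq> E \<and> size S \<le> k} \<subseteq> mset ` {xs. set xs \<subseteq> E \<and> length xs \<le> k}"
  proof
    fix S assume S: "S \<in> {S. set_mset S \<subseteq> E \<and> size S \<le> k}"
    obtain xs where "mset xs = S" using ex_mset by blast
    then show "S \<in> mset ` {xs. set xs \<subseteq> E \<and> length xs \<le> k}" using S by auto
  qed
  show "finite (mset ` {xs. set xs \<subseteq> E \<and> length xs \<le> k})"
    using finite_lists_length_le[OF assms] by simp
qed

lemma poly_deg_le_monomial:
  assumes S: "S \<subseteq> edges n" "card S \<le> k"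
  shows "poly_deg_le n k (\<lambda>x. \<Prod>e\<in>S. x e)"
proof -
  let ?M = "{T. set_mset T \<subseteq> edges n \<and> size T \<le> k}"
  have fin: "finite S" using S(1) finite_edges by (rule finite_subset)
  then have "mset_set S \<in> ?M" using S by simp
  \<comment> \<open>Over an infinite index set the sum in \<open>poly_deg_le\<close> would be 0 by
    convention; finiteness lets it pick out the one monomial.\<close>
  moreover have "finite ?M" by (rule finite_bounded_multisets) simp
  ultimately have "(\<Prod>e\<in>S. x e) = (\<Sum>T\<in>?M. of_bool (T = mset_set S) * (\<Prod>e\<in>#T. x e))" for x :: "nat set \<Rightarrow> real"
    by (simp add: of_bool_def if_distrib[of "\<lambda>a. a * _"] sum.delta prod_unfold_prod_mset cong: if_cong)
  then show ?thesis unfolding poly_deg_le_def by (intro exI[of _ "\<lambda>T. of_bool (T = mset_set S)"]) auto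
qed

text \<open>The test polynomial is the monomial of S, which on X is the indicator of containing S and
  hence equals its own square.\<close>
lemma P_set_ham_count_nonneg:
  assumes n: "n \<ge> 1" and c: "c \<in> P_set n k" and S: "S \<subseteq> edges n" "card S \<le> k"
  shows "0 \<le> (\<Sum>e\<in>edges n. c e * ham_count {1..n} (insert e S))"
proof -
  let ?X = "tsp_vertices n" and ?h = "\<lambda>x :: nat set \<Rightarrow> real. \<Prod>e\<in>S. x e"
  have fin: "finite S" using S(1) finite_edges by (rule finite_subset)
  obtain \<mu> :: real where \<mu>: "\<mu> > 0"
    "\<And>G :: _ \<Rightarrow> real. (\<Sum>xs\<in>orderings n. G (char_vec (cyc xs))) = \<mu> * (\<Sum>x\<in>?X. G x)"
    using sum_orderings[OF n] by blast
  have "0 \<le> q_form n (linfun n c) ?h" using c poly_deg_le_monomial[OF S] by (auto simp: P_set_def)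
  moreover have "real (card ?X) > 0"
    using finite_tsp_vertices[OF n] tsp_vertices_nonempty[OF n] by (simp add: card_gt_0_iff)
  ultimately have "0 \<le> (\<Sum>x\<in>?X. linfun n c x * (?h x)\<^sup>2)"
    by (simp add: q_form_def zero_le_divide_iff)
  then have "0 \<le> \<mu> * (\<Sum>x\<in>?X. linfun n c x * (?h x)\<^sup>2)" using \<mu>(1) by simp
  also have "\<dots> = (\<Sum>xs\<in>orderings n. linfun n c (char_vec (cyc xs)) * (?h (char_vec (cyc xs)))\<^sup>2)"
    by (rule \<mu>(2)[symmetric])
  also have "\<dots> = (\<Sum>xs\<in>orderings n. \<Sum>e\<in>edges n. c e * of_bool (insert e S \<subseteq> cyc xs))"
  proof (rule sum.cong[OF refl])
    fix xs assume "xs \<in> orderings n"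
    have "?h (char_vec (cyc xs)) = of_bool (S \<subseteq> cyc xs)"
    proof (cases "S \<subseteq> cyc xs")
      case False
      then have "\<exists>e\<in>S. char_vec (cyc xs) e = 0" by (auto simp: char_vec_def)
      then show ?thesis using False fin by (simp add: prod_zero_iff)
    qed (auto simp: char_vec_def intro!: prod.neutral)
    then show "linfun n c (char_vec (cyc xs)) * (?h (char_vec (cyc xs)))\<^sup>2
        = (\<Sum>e\<in>edges n. c e * of_bool (insert e S \<subseteq> cyc xs))"
      by (cases "S \<subseteq> cyc xs") (simp_all add: linfun_def char_vec_def)
  qed
  also have "\<dots> = (\<Sum>e\<in>edges n. c e * ham_count {1..n} (insert e S))"
    unfolding ham_count_def sum_distrib_left by (rule sum.swap)
  finally show ?thesis .
qed

text \<open>Adding the inequalities of all test monomials, over rotations r and subsets J, gives the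
  total mass \<tau> times the value of g at the contracted vertex.\<close>

lemma P_set_contracted_vertex_nonneg:
  assumes n: "n \<ge> 4" and k: "k \<le> n div 2" and c: "c \<in> P_set n k" and x: "x \<in> tsp_vertices n"
  defines "b \<equiv> 1 - noncycle_ratio n k * (real n - 1) / 2"
  shows "0 \<le> linfun n c (\<lambda>e. barycenter n e + b * (x e - barycenter n e))"
proof -
  let ?V = "{1..n}" and ?m = "n div 2"
  have V: "finite ?V" "card ?V = n" by auto
  obtain xs where xs: "xs \<in> orderings n" "x = char_vec (cyc xs)" using x n by (auto simp: tsp_vertices_eq)
  define \<tau> where "\<tau> = real n * real (?m choose k) * matching_count ?V k"
  have "matching_count ?V k > 0"
  proof -
    have "ham_count ?V {} > 0" by (simp add: ham_count_def)
    moreover have "(\<Prod>i<k. 2 / (real n - 1 - real i)) > 0"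
      by (rule prod_pos) (use n k in auto)
    ultimately show ?thesis by (simp add: matching_count_def)
  qed
  then have \<tau>: "\<tau> > 0" using n k by (simp add: \<tau>_def)
  have "0 \<le> (\<Sum>e\<in>edges n. c e * ham_count ?V (insert e (pairing (rotate r xs) J)))"
    if "J \<in> ksubsets ?m k" for r J
  proof (rule P_set_ham_count_nonneg[OF _ c])
    have "matching ?V (pairing (rotate r xs) J)" "card (pairing (rotate r xs) J) = k"
      using pairing_matching[OF V n k refl rotate_perm_list[OF V n k refl xs(1)] that] by auto
    then show "pairing (rotate r xs) J \<subseteq> edges n" "card (pairing (rotate r xs) J) \<le> k"
      by (auto simp: edges_eq matching_def)
  qed (use n in simp)
  then have "0 \<le> (\<Sum>r<n. \<Sum>J\<in>ksubsets ?m k. \<Sum>e\<in>edges n.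
      c e * ham_count ?V (insert e (pairing (rotate r xs) J)))"
    by (intro sum_nonneg[of "{..<n}"] sum_nonneg[of "ksubsets ?m k"])
  also have "\<dots> = (\<Sum>e\<in>edges n. c e * weight ?V k xs e)"
    unfolding weight_def V(2) sum_distrib_left
    by (subst (2) sum.swap, subst sum.swap) simp
  also have "\<dots> = (\<Sum>e\<in>edges n. \<tau> * (c e * (barycenter n e + b * (x e - barycenter n e))))"
  proof (rule sum.cong[OF refl])
    fix e assume e: "e \<in> edges n"
    then show "c e * weight ?V k xs e = \<tau> * (c e * (barycenter n e + b * (x e - barycenter n e)))"
      using weight_eq[OF V n k refl xs(1), of e]
      by (simp add: edges_eq \<tau>_def b_def xs(2) char_vec_def barycenter_def)
  qed
  also have "\<dots> = \<tau> * linfun n c (\<lambda>e. barycenter n e + b * (x e - barycenter n e))"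
    by (simp add: linfun_def sum_distrib_left)
  finally show ?thesis using \<tau> by (simp add: zero_le_mult_iff)
qed

text \<open>\<open>barycenter\<close> is defined by its coordinates, so membership of contracted
  points in \<open>tsp_aff\<close> needs this: each edge lies in a fraction 2 / (n - 1) of all
  Hamiltonian cycles.\<close>

lemma barycenter_eq_average:
  assumes n: "n \<ge> 4"
  shows "barycenter n e = (\<Sum>x\<in>tsp_vertices n. 1 / real (card (tsp_vertices n)) * x e)"
proof (cases "e \<in> edges n")
  case False
  have "(\<Sum>x\<in>tsp_vertices n. 1 / real (card (tsp_vertices n)) * x e) = 0"
    by (rule sum.neutral) (use tsp_vertex_support[OF _ _ False] n in simp)
  then show ?thesis using False by (simp only: barycenter_def if_False)
next
  case True
  let ?X = "tsp_vertices n"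
  have n1: "n \<ge> 1" using n by simp
  obtain \<mu> :: real where \<mu>: "\<mu> > 0"
    "\<And>G :: _ \<Rightarrow> real. (\<Sum>xs\<in>orderings n. G (char_vec (cyc xs))) = \<mu> * (\<Sum>x\<in>?X. G x)"
    using sum_orderings[OF n1] by blast
  have cardX: "real (card ?X) > 0"
    using finite_tsp_vertices[OF n1] tsp_vertices_nonempty[OF n1] by (simp add: card_gt_0_iff)
  have "\<mu> * (\<Sum>x\<in>?X. x e) = ham_count {1..n} {e}"
    unfolding \<mu>(2)[symmetric] by (simp add: ham_count_def char_vec_def)
  also have "\<dots> = 2 / (real n - 1) * ham_count {1..n} {}"
    using ham_count_edge[of "{1..n}" e] True n by (simp add: edges_eq)
  also have "ham_count {1..n} {} = \<mu> * real (card ?X)"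
    using \<mu>(2)[of "\<lambda>_. 1"] by (simp add: ham_count_def)
  finally have "\<mu> * (\<Sum>x\<in>?X. x e) = \<mu> * (2 / (real n - 1) * real (card ?X))"
    by (simp only: mult_ac)
  then have "(\<Sum>x\<in>?X. x e) = 2 / (real n - 1) * real (card ?X)"
    using \<mu>(1) unfolding mult_cancel_left by linarith
  then show ?thesis
    using True cardX unfolding sum_distrib_left[symmetric] by (simp add: barycenter_def)
qed

theorem theorem2:
  fixes n k :: nat
  assumes "n \<ge> 9" and "1 \<le> k" and "k \<le> n div 2"
  shows "\<exists>\<alpha>::real. \<bar>\<alpha>\<bar> \<le> 10 / real n \<and>
    (let a = real n / real k + \<alpha>;
         Z = barycenter n
     in (\<lambda>z e. z e - Z e) ` P_polar n k \<subseteq> (\<lambda>z e. z e - Z e) ` tsp_polytope n \<and>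
        (\<lambda>z e. z e - Z e) ` tsp_polytope n \<subseteq> (\<lambda>w e. a * (w e - Z e)) ` P_polar n k)"
proof -
  let ?X = "tsp_vertices n" and ?Z = "barycenter n"
  have n: "n \<ge> 4" "n \<ge> 3" "n \<ge> 1" using assms(1) by auto
  have finX: "finite ?X" and cardX: "real (card ?X) > 0"
    using finite_tsp_vertices[OF n(3)] tsp_vertices_nonempty[OF n(3)] by (auto simp: card_gt_0_iff)
  define b where "b = 1 - noncycle_ratio n k * (real n - 1) / 2"
  obtain \<alpha> where \<alpha>: "\<bar>\<alpha>\<bar> \<le> 10 / real n" "b * (real n / real k + \<alpha>) = 1"
    using noncycle_ratio_inverse[OF assms] unfolding b_def by blast
  define a where "a = real n / real k + \<alpha>"
  have ab: "a * b = 1" using \<alpha>(2) by (simp add: a_def mult.commute)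
  have "(\<lambda>z e. z e - ?Z e) ` tsp_polytope n \<subseteq> (\<lambda>w e. a * (w e - ?Z e)) ` P_polar n k"
  proof (rule image_subsetI)
    fix z assume "z \<in> tsp_polytope n"
    then obtain t where t: "\<forall>x\<in>?X. t x \<ge> 0" "(\<Sum>x\<in>?X. t x) = 1" "z = (\<lambda>e. \<Sum>x\<in>?X. t x * x e)"
      unfolding tsp_polytope_def by blast
    \<comment> \<open>As a * b = 1, this is the only possible preimage of z - Z. Because the t sum
      to 1, it is the same convex combination of the contracted vertices.\<close>
    define w where "w = (\<lambda>e. ?Z e + b * (z e - ?Z e))"
    have w_eq: "w = (\<lambda>e. \<Sum>x\<in>?X. t x * (?Z e + b * (x e - ?Z e)))"
    proof
      fix e
      have "(\<Sum>x\<in>?X. t x * (?Z e + b * (x e - ?Z e)))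
        = (\<Sum>x\<in>?X. t x * ((1 - b) * ?Z e) + b * (t x * x e))"
        by (rule sum.cong) (auto simp: algebra_simps)
      also have "\<dots> = (1 - b) * ?Z e + b * z e"
        unfolding sum.distrib sum_distrib_right[symmetric] sum_distrib_left[symmetric] t(2) t(3) by simp
      finally show "w e = (\<Sum>x\<in>?X. t x * (?Z e + b * (x e - ?Z e)))"
        by (simp add: w_def algebra_simps)
    qed
    have "w \<in> tsp_aff n"
    proof -
      \<comment> \<open>The weights mix the uniform ones of Z with those of z;
        \<open>tsp_aff\<close> asks only that they sum to 1.\<close>
      have "w = (\<lambda>e. \<Sum>x\<in>?X. ((1 - b) / real (card ?X) + b * t x) * x e)"
      proof
        fix e
        have "w e = (1 - b) * ?Z e + b * z e" by (simp add: w_def algebra_simps)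
        also have "\<dots> = (\<Sum>x\<in>?X. (1 - b) * (1 / real (card ?X) * x e)) + (\<Sum>x\<in>?X. b * (t x * x e))"
          by (simp only: barycenter_eq_average[OF n(1)] t(3) sum_distrib_left)
        also have "\<dots> = (\<Sum>x\<in>?X. ((1 - b) / real (card ?X) + b * t x) * x e)"
          unfolding sum.distrib[symmetric] by (rule sum.cong) (auto simp: distrib_right)
        finally show "w e = (\<Sum>x\<in>?X. ((1 - b) / real (card ?X) + b * t x) * x e)" .
      qed
      moreover have "(\<Sum>x\<in>?X. (1 - b) / real (card ?X) + b * t x) = 1"
        unfolding sum.distrib sum_distrib_left[symmetric] t(2) using cardX by simp
      ultimately show ?thesis unfolding tsp_aff_def by blast
    qed
    moreover have "0 \<le> linfun n c w" if "c \<in> P_set n k" for c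
      unfolding linfun_combination[OF finX w_eq] b_def
      using t(1) P_set_contracted_vertex_nonneg[OF n(1) assms(3) that]
      by (intro sum_nonneg mult_nonneg_nonneg) auto
    ultimately have "w \<in> P_polar n k" by (simp add: P_polar_def)
    moreover have "(\<lambda>e. z e - ?Z e) = (\<lambda>e. a * (w e - ?Z e))"
      using ab by (simp add: w_def mult.assoc[symmetric])
    ultimately show "(\<lambda>e. z e - ?Z e) \<in> (\<lambda>w e. a * (w e - ?Z e)) ` P_polar n k" by blast
  qed
  moreover have "(\<lambda>z e. z e - ?Z e) ` P_polar n k \<subseteq> (\<lambda>z e. z e - ?Z e) ` tsp_polytope n"
    by (rule image_mono[OF P_polar_subset_tsp_polytope[OF n(2)]])
  ultimately show ?thesis
    using \<alpha>(1) unfolding Let_def a_def by blast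
qed

end
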